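(* Let $g:[-1,1]\to\mathbb{R}$ be a nonnegative smooth function, let $\omega>0$, and let $\phi_\omega(x)=\sin(\omega x)$ or $\phi_\omega(x)=\cos(\omega x)$, with the weight $W_\omega(x):=(g\circ\phi_\omega)(x)$ not almost everywhere zero on $[-1,1]$. For $n\ge 0$, let $\{x_k,w_k\}_{k=1}^n$ be the $n$-point Gaussian quadrature rule for the weight $W_\omega$ on $[-1,1]$ (the nodes $x_k$ are the zeros of the degree-$n$ polynomial orthogonal with respect to $W_\omega$ on $[-1,1]$, and the weights $w_k$ are such that the rule is exact for all polynomials of degree at most $2n-1$; for $n=0$ the rule is the empty sum), and define the remainder $$R_n[f]=\int_{-1}^1 f(x)\,(g\circ\phi_\omega)(x)\,dx-\sum_{k=1}^n w_k f(x_k).$$ Let $\mathcal{K}_\omega=\int_{-1}^1 (g\circ\phi_\omega)(x)\,dx$. (i) If $f$ is analytic with $|f(z)|\le M_\rho$ in the region bounded by the ellipse with foci $\pm1$ and major and minor semiaxis lengths summing to $\rho>1$, then for each $n\ge 0$, $$|R_n[f]|\le \frac{4\mathcal{K}_\omega M_\rho}{\rho^{2n}(1-\rho^{-1})}.$$ (ii) If for some $m\in\mathbb{N}$ the functions $f,f',\ldots,f^{(m-1)}$ are absolutely continuous on $[-1,1]$ and $f^{(m)}$ is of bounded variation with total variation $V_m$, then for each $n\ge\lfloor (m+2)/2\rfloor$, $$|R_n[f]|\le \frac{4\mathcal{K}_\omega V_m}{\pi m (2n-1)(2n-2)\cdots(2n-m)}.$$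
   Context: Gaussian quadrature with respect to a nonnegative weight: nodes are the zeros of the orthogonal polynomial of degree $n$ (they lie in $(-1,1)$), weights are positive, and the rule integrates exactly all polynomials of degree at most $2n-1$. *)

theory Defs
  imports "HOL-Analysis.Analysis" "HOL-Computational_Algebra.Polynomial"
begin

text \<open>Open region bounded by the ellipse with foci -1, 1 whose semiaxis lengths sum to rho
  (sum of distances to the foci equals 2a = rho + 1/rho).\<close>
definition ellipse_region :: "real \<Rightarrow> complex set" where
  "ellipse_region \<rho> = {z. cmod (z - 1) + cmod (z + 1) < \<rho> + 1 / \<rho>}"

definition abs_continuous_on :: "real \<Rightarrow> real \<Rightarrow> (real \<Rightarrow> real) \<Rightarrow> bool" where
  "abs_continuous_on a b f \<longleftrightarrow>
     (\<forall>\<epsilon>>0. \<exists>\<delta>>0. \<forall>(n::nat) (l::nat \<Rightarrow> real) (r::nat \<Rightarrow> real).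
        (\<forall>i<n. a \<le> l i \<and> l i \<le> r i \<and> r i \<le> b) \<and>
        (\<forall>i<n. \<forall>j<n. i \<noteq> j \<longrightarrow> r i \<le> l j \<or> r j \<le> l i) \<and>
        (\<Sum>i<n. r i - l i) < \<delta> \<longrightarrow> (\<Sum>i<n. \<bar>f (r i) - f (l i)\<bar>) < \<epsilon>)"

definition variation_sums :: "real \<Rightarrow> real \<Rightarrow> (real \<Rightarrow> real) \<Rightarrow> real set" where
  "variation_sums a b f = {(\<Sum>i<n. \<bar>f (t (Suc i)) - f (t i)\<bar>) | n t.
      t 0 = a \<and> t n = b \<and> (\<forall>i<n. t i \<le> t (Suc i))}"

definition bounded_variation_on :: "real \<Rightarrow> real \<Rightarrow> (real \<Rightarrow> real) \<Rightarrow> bool" where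
  "bounded_variation_on a b f \<longleftrightarrow> bdd_above (variation_sums a b f)"

definition total_variation :: "real \<Rightarrow> real \<Rightarrow> (real \<Rightarrow> real) \<Rightarrow> real" where
  "total_variation a b f = Sup (variation_sums a b f)"

definition orthogonal_poly :: "(real \<Rightarrow> real) \<Rightarrow> nat \<Rightarrow> real poly \<Rightarrow> bool" where
  "orthogonal_poly W n p \<longleftrightarrow> p \<noteq> 0 \<and> degree p = n \<and>
     (\<forall>q::real poly. degree q < n \<longrightarrow>
        integral {-1..1} (\<lambda>t. poly p t * poly q t * W t) = 0)"

definition gauss_rule :: "(real \<Rightarrow> real) \<Rightarrow> nat \<Rightarrow> (nat \<Rightarrow> real) \<Rightarrow> (nat \<Rightarrow> real) \<Rightarrow> bool" where
  "gauss_rule W n x w \<longleftrightarrow>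
     (\<exists>p. orthogonal_poly W n p \<and> inj_on x {1..n} \<and> x ` {1..n} = {t. poly p t = 0}) \<and>
     (\<forall>q::real poly. degree q < 2 * n \<longrightarrow>
        integral {-1..1} (\<lambda>t. poly q t * W t) = (\<Sum>k=1..n. w k * poly q (x k)))"

definition remainder_c :: "(real \<Rightarrow> real) \<Rightarrow> nat \<Rightarrow> (nat \<Rightarrow> real) \<Rightarrow> (nat \<Rightarrow> real)
    \<Rightarrow> (complex \<Rightarrow> complex) \<Rightarrow> complex" where
  "remainder_c W n x w f = integral {-1..1} (\<lambda>t. f (of_real t) * of_real (W t))
      - (\<Sum>k=1..n. of_real (w k) * f (of_real (x k)))"

definition remainder_r :: "(real \<Rightarrow> real) \<Rightarrow> nat \<Rightarrow> (nat \<Rightarrow> real) \<Rightarrow> (nat \<Rightarrow> real)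
    \<Rightarrow> (real \<Rightarrow> real) \<Rightarrow> real" where
  "remainder_r W n x w f = integral {-1..1} (\<lambda>t. f t * W t) - (\<Sum>k=1..n. w k * f (x k))"

end

theory Submission
  imports Defs "HOL-Complex_Analysis.Cauchy_Integral_Theorem"
begin

text \<open>
  Expand \<open>f\<close> in a Chebyshev series \<open>\<Sum> a\<^sub>k T\<^sub>k\<close>. The rule is exact on \<open>T\<^sub>k\<close> for \<open>k < 2n\<close>; for every
  continuous \<open>h\<close> bounded by \<open>B\<close> on the interval the remainder is at most \<open>2 K B\<close>, because the nodes lie in
  the interval and the weights are nonnegative with sum \<open>K\<close>. Hence the remainder of \<open>f\<close> is at most
  \<open>2 K \<Sum>\<^sub>k\<^sub>\<ge>\<^sub>2\<^sub>n |a\<^sub>k|\<close>. For analytic \<open>f\<close> the substitution \<open>(z + 1/z)/2\<close> turns \<open>a\<^sub>k\<close> into a contour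
  integral over the unit circle, which can be moved to radius \<open>r < \<rho>\<close>, so \<open>|a\<^sub>k| \<le> 2 M / \<rho>\<^sup>k\<close> and the
  tail is geometric. For \<open>f\<close> with \<open>f\<^sup>(\<^sup>m\<^sup>)\<close> of bounded variation, integrating by parts gives
  \<open>a\<^sub>k(f) = (a\<^sub>k\<^sub>-\<^sub>1(f') - a\<^sub>k\<^sub>+\<^sub>1(f')) / (2k)\<close>, so \<open>|a\<^sub>k| \<le> 2 V / (\<pi> k (k-1) \<dots> (k-m))\<close>, and the
  tail telescopes.
\<close>

subsection \<open>Quadrature with a nonnegative weight\<close>

lemma integral_eq_0_nonneg_imp_zero:
  fixes h :: "real \<Rightarrow> real"
  assumes "continuous_on {a..b} h" "\<And>t. t \<in> {a..b} \<Longrightarrow> 0 \<le> h t"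
    and "integral {a..b} h = 0" "a < b" "t \<in> {a..b}"
  shows "h t = 0"
  using integral_eq_0_iff[of a b h] assms by auto

text \<open>The sign of the weights and the location of the nodes are derived below from exactness
  in degree less than \<open>2 * n\<close>; for \<open>n = 0\<close> the rule is the empty
  sum.\<close>

locale gauss_quadrature =
  fixes W :: "real \<Rightarrow> real" and n :: nat and x w :: "nat \<Rightarrow> real"
  assumes W_cont: "continuous_on {-1..1} W"
    and W_nonneg: "\<And>t. t \<in> {-1..1} \<Longrightarrow> 0 \<le> W t"
    and W_nonzero: "\<exists>t\<in>{-1..1}. W t \<noteq> 0"
    and exact: "\<And>q :: real poly. degree q < 2 * n \<Longrightarrow>
        integral {-1..1} (\<lambda>t. poly q t * W t) = (\<Sum>k=1..n. w k * poly q (x k))"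
begin

text \<open>By continuity one nonzero value of \<open>W\<close> persists on an interval. Infinitely
  many points are what is needed: a nonzero polynomial cannot vanish at all of them.\<close>

lemma W_infinite_support: "infinite {t\<in>{-1..1}. W t \<noteq> 0}"
proof -
  obtain t where t: "t \<in> {-1..1}" "W t \<noteq> 0" using W_nonzero by blast
  have "openin (top_of_set {-1..1}) ({-1..1} \<inter> W -` (-{0}))"
    using W_cont by (intro continuous_openin_preimage_gen) auto
  then obtain U where U: "open U" "{-1..1} \<inter> W -` (-{0}) = {-1..1} \<inter> U"
    by (auto simp: openin_open)
  have UW: "s \<in> U \<longleftrightarrow> W s \<noteq> 0" if "s \<in> {-1..1}" for s
    using U(2) that by blast
  with t have "t \<in> U" by blast
  then obtain e where e: "e > 0" "ball t e \<subseteq> U" using U(1) open_contains_ball by blast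
  define c d where "c = max (-1) (t - e)" and "d = min 1 (t + e)"
  have "c < d" using t e by (auto simp: c_def d_def)
  moreover have "{c<..<d} \<subseteq> {t\<in>{-1..1}. W t \<noteq> 0}"
  proof
    fix s assume "s \<in> {c<..<d}"
    then have "s \<in> {-1..1}" "s \<in> ball t e" by (auto simp: c_def d_def dist_real_def)
    then show "s \<in> {t\<in>{-1..1}. W t \<noteq> 0}" using UW e(2) by blast
  qed
  ultimately show ?thesis using infinite_Ioo finite_subset by blast
qed

text \<open>A continuous nonnegative integrand with zero integral vanishes identically, which would
  put the infinite support of \<open>W\<close> inside the finite root set of
  \<open>q\<close>.\<close>

lemma integral_poly_pos:
  fixes q :: "real poly"
  assumes "q \<noteq> 0" "\<And>t. t \<in> {-1..1} \<Longrightarrow> 0 \<le> poly q t"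
  shows "0 < integral {-1..1} (\<lambda>t. poly q t * W t)"
proof -
  have c: "continuous_on {-1..1} (\<lambda>t. poly q t * W t)"
    by (intro continuous_intros W_cont)
  have nn: "0 \<le> poly q t * W t" if "t \<in> {-1..1}" for t
    using assms(2) W_nonneg that by simp
  have "integral {-1..1} (\<lambda>t. poly q t * W t) \<noteq> 0"
  proof
    assume "integral {-1..1} (\<lambda>t. poly q t * W t) = 0"
    then have "{t\<in>{-1..1}. W t \<noteq> 0} \<subseteq> {t. poly q t = 0}"
      using integral_eq_0_nonneg_imp_zero[OF c nn] by auto
    then show False using W_infinite_support poly_roots_finite[OF assms(1)] finite_subset by blast
  qed
  moreover have "0 \<le> integral {-1..1} (\<lambda>t. poly q t * W t)"
    using nn c by (intro integral_nonneg integrable_continuous_real) auto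
  ultimately show ?thesis by simp
qed

section \<open>Signs of the weights and location of the nodes\<close>

definition other_nodes :: "nat \<Rightarrow> real poly" where
  "other_nodes j = (\<Prod>k\<in>{1..n} - {j}. [:- x k, 1:])"

lemma other_nodes_nonzero: "other_nodes j \<noteq> 0"
  by (auto simp: other_nodes_def prod_zero_iff)

lemma degree_other_nodes: "j \<in> {1..n} \<Longrightarrow> degree (other_nodes j) = n - 1"
  unfolding other_nodes_def by (subst degree_prod_eq_sum_degree) auto

lemma poly_other_nodes_eq_0: "k \<in> {1..n} \<Longrightarrow> k \<noteq> j \<Longrightarrow> poly (other_nodes j) (x k) = 0"
  unfolding other_nodes_def poly_prod by (rule prod_zero) (auto intro!: bexI[of _ k])

text \<open>\<open>other_nodes j\<close> is the unnormalised Lagrange basis polynomial at node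
  \<open>j\<close>. Its square has degree \<open>2 * n - 2\<close>, so the rule is exact on it, and
  every term of the rule except the \<open>j\<close>-th vanishes while the integral is
  positive.\<close>

lemma weight_nonneg:
  assumes j: "j \<in> {1..n}"
  shows "0 \<le> w j"
proof -
  let ?q = "other_nodes j ^ 2"
  have "degree ?q < 2 * n"
    using j degree_other_nodes[OF j] other_nodes_nonzero by (simp add: degree_power_eq)
  then have "integral {-1..1} (\<lambda>t. poly ?q t * W t) = (\<Sum>k=1..n. w k * poly ?q (x k))"
    by (rule exact)
  also have "\<dots> = (\<Sum>k\<in>{j}. w k * poly ?q (x k))"
    using j poly_other_nodes_eq_0 by (intro sum.mono_neutral_right) auto
  finally have "0 < w j * poly ?q (x j)"
    using integral_poly_pos[of ?q] other_nodes_nonzero by simp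
  then show ?thesis by (simp add: zero_less_mult_iff)
qed

text \<open>A node outside the interval would make \<open>(t - x\<^sub>j) \<Prod>\<^sub>k\<^sub>\<noteq>\<^sub>j (t - x\<^sub>k)\<^sup>2\<close> a polynomial of one sign,
  integrated exactly by the rule, vanishing at every node.\<close>
lemma node_mem:
  assumes j: "j \<in> {1..n}"
  shows "x j \<in> {-1..1}"
proof (rule ccontr)
  assume out: "x j \<notin> {-1..1}"
  \<comment> \<open>Sign that makes \<open>s * (t - x j)\<close> nonnegative on the interval,
    whichever side the node lies on.\<close>
  define s :: real where "s = (if x j < -1 then 1 else -1)"
  let ?q = "smult s [:- x j, 1:] * other_nodes j ^ 2"
  have s: "s \<noteq> 0" by (simp add: s_def)
  have nz: "?q \<noteq> 0" using other_nodes_nonzero s by (simp del: mult_smult_left mult_pCons_left smult_pCons)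
  have "degree ?q = 1 + 2 * (n - 1)"
    using j degree_other_nodes[OF j] other_nodes_nonzero s
    by (subst degree_mult_eq) (auto simp: degree_power_eq)
  then have "degree ?q < 2 * n" using j by auto
  then have "integral {-1..1} (\<lambda>t. poly ?q t * W t) = (\<Sum>k=1..n. w k * poly ?q (x k))"
    by (rule exact)
  also have "\<dots> = 0"
    using poly_other_nodes_eq_0[of _ j] by (intro sum.neutral) force
  finally have "integral {-1..1} (\<lambda>t. poly ?q t * W t) = 0" .
  moreover have "0 \<le> poly ?q t" if "t \<in> {-1..1}" for t
    using that out by (auto simp: s_def algebra_simps intro!: mult_right_mono)
  ultimately show False using integral_poly_pos[OF nz] by simp
qed

section \<open>Size and linearity of the remainder\<close>

lemma sum_weights: "n > 0 \<Longrightarrow> (\<Sum>k=1..n. w k) = integral {-1..1} W"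
  using exact[of 1] by simp

lemma integral_W_nonneg: "0 \<le> integral {-1..1} W"
  using W_nonneg W_cont by (intro integral_nonneg integrable_continuous_real) auto

text \<open>Integration against \<open>W\<close> and the rule are both positive functionals whose
  mass is at most the integral of \<open>W\<close>; each contributes one of the two copies of the
  bound.\<close>

lemma remainder_le_sup:
  assumes h: "continuous_on {-1..1} h" and B: "\<And>t. t \<in> {-1..1} \<Longrightarrow> \<bar>h t\<bar> \<le> B"
  shows "\<bar>remainder_r W n x w h\<bar> \<le> 2 * integral {-1..1} W * B"
proof -
  have B0: "0 \<le> B" using B[of 0] by auto
  have "norm (integral {-1..1} (\<lambda>t. h t * W t)) \<le> integral {-1..1} (\<lambda>t. B * W t)"
    using W_nonneg B
    by (intro integral_norm_bound_integral integrable_continuous_real continuous_intros h W_cont)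
       (auto simp: abs_mult B0 intro!: mult_mono)
  then have 1: "\<bar>integral {-1..1} (\<lambda>t. h t * W t)\<bar> \<le> integral {-1..1} W * B"
    by (simp add: mult.commute)
  have "\<bar>\<Sum>k=1..n. w k * h (x k)\<bar> \<le> (\<Sum>k=1..n. w k * B)"
    by (rule order_trans[OF sum_abs])
       (auto intro!: sum_mono mult_mono B node_mem simp: abs_mult weight_nonneg)
  \<comment> \<open>For \<open>n > 0\<close> the weights sum to the mass of \<open>W\<close>, by
    exactness on the constant 1; for \<open>n = 0\<close> the left side is the empty sum.\<close>
  also have "\<dots> \<le> integral {-1..1} W * B"
    using sum_weights B0 integral_W_nonneg
    by (cases "n > 0") (auto simp flip: sum_distrib_right)
  finally show ?thesis using 1 unfolding remainder_r_def by (simp add: abs_le_iff)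
qed

lemma remainder_sum:
  assumes "\<And>k. k \<in> A \<Longrightarrow> continuous_on {-1..1} (h k)" "finite A"
  shows "remainder_r W n x w (\<lambda>t. \<Sum>k\<in>A. c k * h k t) = (\<Sum>k\<in>A. c k * remainder_r W n x w (h k))"
proof -
  have "integral {-1..1} (\<lambda>t. \<Sum>k\<in>A. c k * (h k t * W t)) = (\<Sum>k\<in>A. c k * integral {-1..1} (\<lambda>t. h k t * W t))"
    using assms
    by (subst integral_sum)
       (auto intro!: integrable_continuous_real continuous_intros W_cont)
  moreover have "(\<Sum>i=1..n. w i * (\<Sum>k\<in>A. c k * h k (x i)))
      = (\<Sum>k\<in>A. c k * (\<Sum>i=1..n. w i * h k (x i)))"
    unfolding sum_distrib_left by (subst sum.swap) (simp add: mult.left_commute)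
  ultimately show ?thesis
    unfolding remainder_r_def
    by (simp add: sum_distrib_right right_diff_distrib sum_subtractf mult.assoc)
qed

lemma remainder_diff:
  assumes "continuous_on {-1..1} h" "continuous_on {-1..1} h'"
  shows "remainder_r W n x w (\<lambda>t. h t - h' t) = remainder_r W n x w h - remainder_r W n x w h'"
proof -
  have "integral {-1..1} (\<lambda>t. h t * W t - h' t * W t)
      = integral {-1..1} (\<lambda>t. h t * W t) - integral {-1..1} (\<lambda>t. h' t * W t)"
    using assms by (intro integral_diff integrable_continuous_real continuous_intros W_cont)
  then show ?thesis
    unfolding remainder_r_def by (simp add: left_diff_distrib right_diff_distrib sum_subtractf)
qed

lemma remainder_poly_eq_0: "degree q < 2 * n \<Longrightarrow> remainder_r W n x w (poly q) = 0"
  unfolding remainder_r_def using exact by simp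

end

subsection \<open>Chebyshev series\<close>

text \<open>With \<open>t = cos \<theta>\<close> this is the usual coefficient for the weight
  \<open>1 / sqrt (1 - t^2)\<close>. The factor \<open>2 / pi\<close> is the same for all
  \<open>k\<close>, so the zeroth coefficient has to be halved in the series.\<close>

definition cheb_coeff :: "(real \<Rightarrow> real) \<Rightarrow> nat \<Rightarrow> real" where
  "cheb_coeff f k = 2 / pi * integral {0..pi} (\<lambda>\<theta>. f (cos \<theta>) * cos (real k * \<theta>))"

text \<open>Three-term recurrence \<open>T_(k+2) = 2 t T_(k+1) - T_k\<close>, from adding the
  formulas for the cosine of a sum and of a difference.\<close>

lemma cos_mult_eq_poly_cos:
  "\<exists>p :: real poly. degree p \<le> k \<and> (\<forall>\<theta>. poly p (cos \<theta>) = cos (real k * \<theta>))"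
proof (induction k rule: induct_nat_012)
  case 0
  show ?case by (rule exI[of _ 1]) simp
next
  case 1
  show ?case by (rule exI[of _ "[:0, 1:]"]) simp
next
  case (ge2 k)
  then obtain p q :: "real poly" where p: "degree p \<le> k" "\<And>\<theta>. poly p (cos \<theta>) = cos (real k * \<theta>)"
    and q: "degree q \<le> Suc k" "\<And>\<theta>. poly q (cos \<theta>) = cos (real (Suc k) * \<theta>)" by metis
  let ?r = "[:0, 2:] * q - p"
  have "degree ([:0, 2:] * q) \<le> Suc (Suc k)"
    using q(1) degree_mult_le[of "[:0, 2:]" q] by simp
  then have "degree ?r \<le> Suc (Suc k)" using p(1) by (intro degree_diff_le) auto
  moreover have "poly ?r (cos \<theta>) = cos (real (Suc (Suc k)) * \<theta>)" for \<theta>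
    using cos_add[of "real (Suc k) * \<theta>" \<theta>] cos_diff[of "real (Suc k) * \<theta>" \<theta>]
    by (simp add: p(2) q(2) algebra_simps)
  ultimately show ?case by blast
qed

text \<open>The Chebyshev polynomial of the first kind. A polynomial is determined by its values on
  the range of \<open>cos\<close>, so the choice is unique.\<close>

definition cheb_poly :: "nat \<Rightarrow> real poly" where
  "cheb_poly k = (SOME p. degree p \<le> k \<and> (\<forall>\<theta>. poly p (cos \<theta>) = cos (real k * \<theta>)))"

lemma degree_cheb_poly_le: "degree (cheb_poly k) \<le> k"
  and poly_cheb_poly_cos: "poly (cheb_poly k) (cos \<theta>) = cos (real k * \<theta>)"
  using someI_ex[OF cos_mult_eq_poly_cos[of k]] unfolding cheb_poly_def by auto

lemma abs_poly_cheb_poly_le: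
  assumes "t \<in> {-1..1}"
  shows "\<bar>poly (cheb_poly k) t\<bar> \<le> 1"
  using poly_cheb_poly_cos[of k "arccos t"] assms by simp

section \<open>Orthogonality and completeness of the cosines on \<open>[0, pi]\<close>\<close>

lemma integral_cos_int_mult:
  "integral {0..pi} (\<lambda>\<theta>. cos (of_int i * \<theta>)) = (if i = 0 then pi else 0)"
proof (cases "i = 0")
  case False
  have "((\<lambda>\<theta>. cos (of_int i * \<theta>)) has_integral
      (sin (of_int i * pi) / of_int i - sin (of_int i * 0) / of_int i)) {0..pi}"
    using False
    by (intro fundamental_theorem_of_calculus)
       (auto intro!: derivative_eq_intros simp flip: has_real_derivative_iff_has_vector_derivative)
  then show ?thesis using False by (simp add: integral_unique sin_zero_iff_int2)
qed simp

text \<open>The product formula leaves the frequencies \<open>j - k\<close> and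
  \<open>j + k\<close>; the first may be negative, which is why the preceding integral is stated for
  integers.\<close>

lemma integral_cos_mult_cos:
  "integral {0..pi} (\<lambda>\<theta>. cos (real j * \<theta>) * cos (real k * \<theta>))
    = (if j = k then if k = 0 then pi else pi / 2 else 0)"
proof -
  have "(\<lambda>\<theta>. cos (real j * \<theta>) * cos (real k * \<theta>)) =
      (\<lambda>\<theta>. (cos (of_int (int j - int k) * \<theta>) + cos (of_int (int j + int k) * \<theta>)) / 2)"
    by (auto simp: cos_times_cos algebra_simps)
  then have "integral {0..pi} (\<lambda>\<theta>. cos (real j * \<theta>) * cos (real k * \<theta>)) =
     (integral {0..pi} (\<lambda>\<theta>. cos (of_int (int j - int k) * \<theta>)) +
      integral {0..pi} (\<lambda>\<theta>. cos (of_int (int j + int k) * \<theta>))) / 2"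
    by (simp only: integral_divide)
       (subst integral_add; auto intro!: integrable_continuous_real continuous_intros)
  then show ?thesis unfolding integral_cos_int_mult by auto
qed

lemma le_if_le_add_mult_eps:
  fixes a b c :: real
  assumes "0 \<le> c" "\<And>e. e > 0 \<Longrightarrow> a \<le> b + c * e"
  shows "a \<le> b"
proof (rule field_le_epsilon)
  fix e :: real assume "e > 0"
  \<comment> \<open>Dividing by \<open>c + 1\<close> instead of \<open>c\<close> covers
    \<open>c = 0\<close>.\<close>
  then have "a \<le> b + c * (e / (c + 1))" using assms by (intro assms(2)) simp
  also have "\<dots> \<le> b + e" using assms(1) \<open>e > 0\<close> by (simp add: field_simps)
  finally show "a \<le> b + e" .
qed

text \<open>Stone-Weierstrass approximates \<open>G (arccos t)\<close> by a polynomial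
  \<open>h\<close>, so \<open>G\<close> is within \<open>e\<close> of
  \<open>h (cos \<theta>)\<close>. The latter is orthogonal to \<open>G\<close>, hence the integral
  of \<open>G^2\<close> is at most \<open>e\<close> times that of
  \<open>\<bar>G\<bar>\<close>.\<close>

lemma cos_coeffs_zero_imp_zero:
  fixes G :: "real \<Rightarrow> real"
  assumes cont: "continuous_on {0..pi} G"
    and zero: "\<And>k. integral {0..pi} (\<lambda>\<theta>. G \<theta> * cos (real k * \<theta>)) = 0"
    and \<theta>: "\<theta> \<in> {0..pi}"
  shows "G \<theta> = 0"
proof -
  have int: "(\<lambda>\<theta>. G \<theta> * h \<theta>) integrable_on {0..pi}" if "continuous_on {0..pi} h" for h
    by (intro integrable_continuous_real continuous_intros cont that)
  have zero_int: "integral {0..pi} (\<lambda>\<theta>. G \<theta> * cos (of_int k * \<theta>)) = 0" for k :: int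
    using zero[of "nat \<bar>k\<bar>"] by (cases "k \<ge> 0") auto
  \<comment> \<open>Frequency 0 is the case used below, but the induction needs all of them: a
    factor \<open>cos \<theta>\<close> shifts the frequency by one in both directions, also to
    negative values.\<close>
  have zero_pow: "integral {0..pi} (\<lambda>\<theta>. G \<theta> * (cos (of_int k * \<theta>) * cos \<theta> ^ i)) = 0" for i and k :: int
  proof (induction i arbitrary: k)
    case 0
    then show ?case using zero_int by simp
  next
    case (Suc i)
    have eq: "G \<theta> * (cos (of_int k * \<theta>) * cos \<theta> ^ Suc i) =
        (G \<theta> * (cos (of_int (k - 1) * \<theta>) * cos \<theta> ^ i) + G \<theta> * (cos (of_int (k + 1) * \<theta>) * cos \<theta> ^ i)) / 2" for \<theta>
    proof -
      have 1: "cos (of_int k * \<theta>) * cos \<theta> = (cos (of_int (k - 1) * \<theta>) + cos (of_int (k + 1) * \<theta>)) / 2"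
        using cos_add[of "of_int k * \<theta>" \<theta>] cos_diff[of "of_int k * \<theta>" \<theta>]
        by (simp add: algebra_simps)
      have "G \<theta> * (cos (of_int k * \<theta>) * cos \<theta> ^ Suc i) = G \<theta> * (cos (of_int k * \<theta>) * cos \<theta>) * cos \<theta> ^ i"
        by simp
      then show ?thesis unfolding 1 by (simp add: field_simps)
    qed
    show ?case unfolding eq integral_divide
      by (subst integral_add; (intro int continuous_intros)?) (simp only: Suc, simp)
  qed
  have "continuous_on {-1..1} (\<lambda>t. G (arccos t))"
    by (rule continuous_on_compose2[OF cont continuous_on_arccos']) (auto simp: arccos_lbound arccos_ubound)
  note SW = Stone_Weierstrass_real_polynomial_function[OF compact_Icc this]
  have sq: "integral {0..pi} (\<lambda>\<theta>. G \<theta> * G \<theta>) \<le> e * integral {0..pi} (\<lambda>\<theta>. \<bar>G \<theta>\<bar>)" if e: "e > 0" for e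
  proof -
    obtain h where h: "real_polynomial_function h" "\<And>t. t \<in> {-1..1} \<Longrightarrow> \<bar>G (arccos t) - h t\<bar> < e"
      using SW[OF e] by blast
    obtain a N where a: "h = (\<lambda>t. \<Sum>i\<le>N. a i * t ^ i)"
      using h(1) real_polynomial_function_iff_sum by blast
    have approx: "\<bar>G \<theta> - h (cos \<theta>)\<bar> < e" if "\<theta> \<in> {0..pi}" for \<theta>
      using h(2)[of "cos \<theta>"] that by (simp add: arccos_cos)
    have hc: "continuous_on {0..pi} (\<lambda>\<theta>. h (cos \<theta>))" unfolding a by (intro continuous_intros)
    have "integral {0..pi} (\<lambda>\<theta>. G \<theta> * h (cos \<theta>)) = (\<Sum>i\<le>N. a i * integral {0..pi} (\<lambda>\<theta>. G \<theta> * (cos (of_int 0 * \<theta>) * cos \<theta> ^ i)))"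
      unfolding a sum_distrib_left
      by (subst integral_sum) (auto intro!: int integrable_on_mult_right continuous_intros sum.cong simp: mult.left_commute[of _ "a _"])
    also have "\<dots> = 0" unfolding zero_pow by simp
    finally have "integral {0..pi} (\<lambda>\<theta>. G \<theta> * G \<theta>) = integral {0..pi} (\<lambda>\<theta>. G \<theta> * (G \<theta> - h (cos \<theta>)))"
      unfolding right_diff_distrib by (subst integral_diff) (auto intro!: int cont hc)
    also have "\<dots> \<le> integral {0..pi} (\<lambda>\<theta>. e * \<bar>G \<theta>\<bar>)"
    proof (rule integral_le)
      fix \<theta> assume "\<theta> \<in> {0..pi}"
      then have "\<bar>G \<theta> * (G \<theta> - h (cos \<theta>))\<bar> \<le> \<bar>G \<theta>\<bar> * e"
        unfolding abs_mult using approx by (intro mult_left_mono) force+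
      then show "G \<theta> * (G \<theta> - h (cos \<theta>)) \<le> e * \<bar>G \<theta>\<bar>" by (simp add: mult.commute)
    qed (intro int integrable_continuous_real continuous_intros cont hc)+
    finally show ?thesis by simp
  qed
  have "0 \<le> integral {0..pi} (\<lambda>\<theta>. \<bar>G \<theta>\<bar>)"
    by (intro integral_nonneg integrable_continuous_real continuous_intros cont) auto
  then have "integral {0..pi} (\<lambda>\<theta>. G \<theta> * G \<theta>) \<le> 0"
    by (rule le_if_le_add_mult_eps) (use sq in \<open>simp add: mult.commute\<close>)
  moreover have "0 \<le> integral {0..pi} (\<lambda>\<theta>. G \<theta> * G \<theta>)"
    by (intro integral_nonneg int cont) auto
  ultimately have "G \<theta> * G \<theta> = 0"
    using cont \<theta> by (intro integral_eq_0_nonneg_imp_zero[of 0 pi "\<lambda>\<theta>. G \<theta> * G \<theta>"]) (auto intro!: continuous_intros)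
  then show ?thesis by simp
qed

text \<open>Absolute summability gives a uniform limit \<open>S\<close> by the Weierstrass test.
  Integrating term by term, \<open>S\<close> has the same cosine integrals as \<open>f\<close>, so
  \<open>f (cos \<theta>) - S (cos \<theta>)\<close> vanishes by completeness.\<close>

lemma cheb_series_uniform_limit:
  fixes f :: "real \<Rightarrow> real"
  assumes cont: "continuous_on {-1..1} f" and summ: "summable (\<lambda>k. \<bar>cheb_coeff f k\<bar>)"
  defines "c \<equiv> \<lambda>k. if k = 0 then cheb_coeff f 0 / 2 else cheb_coeff f k"
  shows "uniform_limit {-1..1} (\<lambda>N t. \<Sum>k<N. c k * poly (cheb_poly k) t) f sequentially"
proof -
  define S where "S t = (\<Sum>k. c k * poly (cheb_poly k) t)" for t
  have c_le: "\<bar>c k\<bar> \<le> \<bar>cheb_coeff f k\<bar>" for k by (simp add: c_def)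
  have summ_c: "summable (\<lambda>k. \<bar>c k\<bar>)"
    using c_le by (intro summable_comparison_test'[OF summ]) auto
  have term_le: "norm (c k * poly (cheb_poly k) t) \<le> \<bar>c k\<bar>" if "t \<in> {-1..1}" for k t
    using abs_poly_cheb_poly_le[OF that, of k] by (simp add: abs_mult mult_left_le)
  have lim: "uniform_limit {-1..1} (\<lambda>N t. \<Sum>k<N. c k * poly (cheb_poly k) t) S sequentially"
    unfolding S_def by (rule Weierstrass_m_test[OF term_le summ_c])
  have S_cont: "continuous_on {-1..1} S"
    by (rule uniform_limit_theorem[OF _ lim]) (auto intro!: always_eventually continuous_intros)
  have S_sums: "(\<lambda>k. c k * cos (real k * \<theta>)) sums S (cos \<theta>)" for \<theta>
  proof -
    have "summable (\<lambda>k. c k * poly (cheb_poly k) (cos \<theta>))"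
      by (rule summable_comparison_test'[OF summ_c term_le]) auto
    then show ?thesis unfolding S_def by (simp add: summable_sums flip: poly_cheb_poly_cos)
  qed
  have coeff: "integral {0..pi} (\<lambda>\<theta>. S (cos \<theta>) * cos (real j * \<theta>)) =
      integral {0..pi} (\<lambda>\<theta>. f (cos \<theta>) * cos (real j * \<theta>))" for j
  proof -
    let ?F = "\<lambda>N \<theta>. \<Sum>k<N. c k * cos (real k * \<theta>) * cos (real j * \<theta>)"
    have "(\<lambda>\<theta>. \<Sum>k. c k * cos (real k * \<theta>) * cos (real j * \<theta>)) = (\<lambda>\<theta>. S (cos \<theta>) * cos (real j * \<theta>))"
      by (intro ext sums_unique[symmetric] sums_mult2 S_sums)
    moreover have "\<bar>c k * cos (real k * \<theta>) * cos (real j * \<theta>)\<bar> \<le> \<bar>c k\<bar>" for k \<theta>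
      unfolding abs_mult mult.assoc by (intro mult_left_le mult_le_one) auto
    ultimately have "uniform_limit {0..pi} ?F (\<lambda>\<theta>. S (cos \<theta>) * cos (real j * \<theta>)) sequentially"
      using Weierstrass_m_test[OF _ summ_c, of "{0..pi}" "\<lambda>k \<theta>. c k * cos (real k * \<theta>) * cos (real j * \<theta>)"]
      by simp
    then obtain I J where I: "\<And>N. (?F N has_integral I N) {0..pi}"
      and J: "((\<lambda>\<theta>. S (cos \<theta>) * cos (real j * \<theta>)) has_integral J) {0..pi}" and IJ: "I \<longlonglongrightarrow> J"
      by (rule uniform_limit_integral) (auto intro!: continuous_intros)
    \<comment> \<open>By orthogonality only the term \<open>k = j\<close> survives once it is in the
      partial sum, so \<open>I\<close> is eventually constant. The halved \<open>c 0\<close> makes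
      up for the value \<open>pi\<close>, instead of \<open>pi / 2\<close>, at frequency 0.\<close>
    have "I N = integral {0..pi} (\<lambda>\<theta>. f (cos \<theta>) * cos (real j * \<theta>))" if "N > j" for N
    proof -
      have "I N = (\<Sum>k<N. c k * integral {0..pi} (\<lambda>\<theta>. cos (real k * \<theta>) * cos (real j * \<theta>)))"
        unfolding integral_unique[OF I, symmetric] mult.assoc
        by (subst integral_sum) (auto intro!: integrable_continuous_real continuous_intros)
      also have "\<dots> = (\<Sum>k\<in>{j}. c k * integral {0..pi} (\<lambda>\<theta>. cos (real k * \<theta>) * cos (real j * \<theta>)))"
        using that by (intro sum.mono_neutral_right) (auto simp: integral_cos_mult_cos)
      also have "\<dots> = integral {0..pi} (\<lambda>\<theta>. f (cos \<theta>) * cos (real j * \<theta>))"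
        by (simp add: integral_cos_mult_cos c_def cheb_coeff_def)
      finally show ?thesis .
    qed
    then have "I \<longlonglongrightarrow> integral {0..pi} (\<lambda>\<theta>. f (cos \<theta>) * cos (real j * \<theta>))"
      by (intro tendsto_eventually eventually_mono[OF eventually_gt_at_top[of j]])
    then show ?thesis using IJ J LIMSEQ_unique integral_unique by blast
  qed
  have fc: "continuous_on {0..pi} (\<lambda>\<theta>. f (cos \<theta>))" "continuous_on {0..pi} (\<lambda>\<theta>. S (cos \<theta>))"
    by (rule continuous_on_compose2[OF cont] continuous_on_compose2[OF S_cont]; auto intro!: continuous_intros)+
  have "f (cos \<theta>) - S (cos \<theta>) = 0" if "\<theta> \<in> {0..pi}" for \<theta>
  proof (rule cos_coeffs_zero_imp_zero[OF _ _ that])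
    show "continuous_on {0..pi} (\<lambda>\<theta>. f (cos \<theta>) - S (cos \<theta>))" by (intro continuous_intros fc)
    show "integral {0..pi} (\<lambda>\<theta>. (f (cos \<theta>) - S (cos \<theta>)) * cos (real k * \<theta>)) = 0" for k
      unfolding left_diff_distrib
      by (subst integral_diff) (auto intro!: integrable_continuous_real continuous_intros fc simp: coeff)
  qed
  then have f_cos: "f (cos \<theta>) = S (cos \<theta>)" if "\<theta> \<in> {0..pi}" for \<theta> using that by force
  have "f t = S t" if "t \<in> {-1..1}" for t
    using that f_cos[of "arccos t"] by (simp add: arccos_lbound arccos_ubound)
  then show ?thesis using lim by (subst uniform_limit_cong'[OF refl, of _ _ S])
qed

context gauss_quadrature begin

text \<open>A long partial sum replaces \<open>f\<close> up to a uniform error \<open>e\<close>. Its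
  terms of index below \<open>2 * n\<close> have zero remainder, each later \<open>T_k\<close> has
  remainder at most twice the mass of \<open>W\<close>, and \<open>e\<close> tends to 0.\<close>

lemma remainder_le_cheb_tail:
  assumes cont: "continuous_on {-1..1} f"
    and tail: "\<And>N. (\<Sum>k=2*n..<N. \<bar>cheb_coeff f k\<bar>) \<le> B"
  shows "\<bar>remainder_r W n x w f\<bar> \<le> 2 * integral {-1..1} W * B"
proof (rule le_if_le_add_mult_eps)
  let ?R = "remainder_r W n x w" and ?K = "integral {-1..1} W"
  show "0 \<le> 2 * ?K" using integral_W_nonneg by simp
  define c where "c k = (if k = 0 then cheb_coeff f 0 / 2 else cheb_coeff f k)" for k
  fix e :: real assume "e > 0"
  \<comment> \<open>The common bound on the finite tails already makes the whole series converge
    absolutely.\<close>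
  have "summable (\<lambda>k. \<bar>cheb_coeff f k\<bar>)"
  proof (rule summableI_nonneg_bounded)
    fix N
    have "(\<Sum>k<N. \<bar>cheb_coeff f k\<bar>) \<le> (\<Sum>k\<in>{..<2*n} \<union> {2*n..<N}. \<bar>cheb_coeff f k\<bar>)"
      by (intro sum_mono2) auto
    also have "\<dots> = (\<Sum>k<2*n. \<bar>cheb_coeff f k\<bar>) + (\<Sum>k=2*n..<N. \<bar>cheb_coeff f k\<bar>)"
      by (intro sum.union_disjoint) auto
    finally show "(\<Sum>k<N. \<bar>cheb_coeff f k\<bar>) \<le> (\<Sum>k<2*n. \<bar>cheb_coeff f k\<bar>) + B"
      using tail[of N] by simp
  qed simp
  from cheb_series_uniform_limit[OF cont this] have
    "uniform_limit {-1..1} (\<lambda>N t. \<Sum>k<N. c k * poly (cheb_poly k) t) f sequentially"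
    unfolding c_def .
  from uniform_limitD[OF this \<open>e > 0\<close>] obtain N
    where N: "\<And>t. t \<in> {-1..1} \<Longrightarrow> \<bar>(\<Sum>k<N. c k * poly (cheb_poly k) t) - f t\<bar> < e"
    unfolding eventually_sequentially dist_real_def by blast
  let ?S = "\<lambda>t. \<Sum>k<N. c k * poly (cheb_poly k) t"
  have S_cont: "continuous_on {-1..1} ?S" by (intro continuous_intros)
  have "\<bar>?R (\<lambda>t. f t - ?S t)\<bar> \<le> 2 * ?K * e"
    using N by (intro remainder_le_sup continuous_on_diff cont S_cont) (force simp: abs_minus_commute)
  moreover have "?R (\<lambda>t. f t - ?S t) = ?R f - ?R ?S" by (rule remainder_diff[OF cont S_cont])
  moreover have "\<bar>?R ?S\<bar> \<le> 2 * ?K * B"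
  proof -
    have 0: "?R (poly (cheb_poly k)) = 0" if "k < 2 * n" for k
      using degree_cheb_poly_le[of k] that by (intro remainder_poly_eq_0) simp
    have le: "\<bar>c k * ?R (poly (cheb_poly k))\<bar> \<le> \<bar>cheb_coeff f k\<bar> * (2 * ?K)" for k
    proof -
      have "\<bar>?R (poly (cheb_poly k))\<bar> \<le> 2 * ?K * 1"
        by (intro remainder_le_sup continuous_intros abs_poly_cheb_poly_le)
      then show ?thesis unfolding abs_mult by (intro mult_mono) (auto simp: c_def)
    qed
    have "\<bar>?R ?S\<bar> = \<bar>\<Sum>k<N. c k * ?R (poly (cheb_poly k))\<bar>"
      by (subst remainder_sum) (auto intro!: continuous_intros)
    also have "\<dots> = \<bar>\<Sum>k=2*n..<N. c k * ?R (poly (cheb_poly k))\<bar>"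
      using 0 by (intro arg_cong[where f=abs] sum.mono_neutral_right) auto
    also have "\<dots> \<le> (\<Sum>k=2*n..<N. \<bar>cheb_coeff f k\<bar> * (2 * ?K))"
      by (rule order_trans[OF sum_abs sum_mono[OF le]])
    also have "\<dots> = (\<Sum>k=2*n..<N. \<bar>cheb_coeff f k\<bar>) * (2 * ?K)"
      by (simp add: sum_distrib_right)
    also have "\<dots> \<le> B * (2 * ?K)"
      using tail integral_W_nonneg by (intro mult_right_mono) auto
    finally show ?thesis by (simp add: mult.commute)
  qed
  ultimately show "\<bar>?R f\<bar> \<le> 2 * ?K * B + 2 * ?K * e" by simp
qed

end

subsection \<open>Analytic integrands\<close>

text \<open>The Joukowski map sends \<open>cmod z = r\<close> into the ellipse with focal distance
  sum \<open>r + 1 / r\<close>: the distances to the foci are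
  \<open>cmod (z - 1) ^ 2 / (2 r)\<close> and \<open>cmod (z + 1) ^ 2 / (2 r)\<close>, and the
  parallelogram law adds them.\<close>

lemma joukowski_mem_ellipse_region:
  assumes "1 / \<rho> < cmod z" "cmod z < \<rho>" "\<rho> > 1"
  shows "(z + 1 / z) / 2 \<in> ellipse_region \<rho>"
proof -
  define r where "r = cmod z"
  have z: "z \<noteq> 0" using assms by auto
  have r: "r > 0" using z by (simp add: r_def)
  have "(z + 1 / z) / 2 - 1 = (z - 1)\<^sup>2 / (2 * z)" "(z + 1 / z) / 2 + 1 = (z + 1)\<^sup>2 / (2 * z)"
    using z by (simp_all add: field_simps power2_eq_square)
  then have "cmod ((z + 1 / z) / 2 - 1) + cmod ((z + 1 / z) / 2 + 1)
      = ((cmod (z - 1))\<^sup>2 + (cmod (z + 1))\<^sup>2) / (2 * r)"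
    by (simp add: norm_divide norm_power norm_mult r_def add_divide_distrib)
  also have "(cmod (z - 1))\<^sup>2 + (cmod (z + 1))\<^sup>2 = 2 * r\<^sup>2 + 2"
    unfolding r_def cmod_power2 by (simp add: power2_eq_square algebra_simps)
  also have "(2 * r\<^sup>2 + 2) / (2 * r) = r + 1 / r"
    using r by (simp add: field_simps power2_eq_square)
  also have "r + 1 / r < \<rho> + 1 / \<rho>"
  proof -
    \<comment> \<open>This product is \<open>r * \<rho>\<close> times
      \<open>(\<rho> + 1 / \<rho>) - (r + 1 / r)\<close>.\<close>
    have "0 < (\<rho> - r) * (\<rho> * r - 1)"
      using assms by (intro mult_pos_pos) (auto simp: r_def field_simps)
    then have "r * r * \<rho> + \<rho> < \<rho> * \<rho> * r + r"
      by (simp add: algebra_simps)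
    then show ?thesis using r assms(3) by (simp add: field_simps)
  qed
  finally show ?thesis by (simp add: ellipse_region_def)
qed

lemma joukowski_cis: "(cis \<theta> + 1 / cis \<theta>) / 2 = of_real (cos \<theta>)"
proof -
  have "1 / cis \<theta> = cis (- \<theta>)" by (simp add: divide_inverse)
  moreover have "(cis \<theta> + cis (- \<theta>)) / 2 = of_real (cos \<theta>)" by (simp add: complex_eq_iff)
  ultimately show ?thesis by argo
qed

lemma real_mem_ellipse_region:
  assumes "\<rho> > 1" "t \<in> {-1..1}"
  shows "complex_of_real t \<in> ellipse_region \<rho>"
proof -
  have "(cis (arccos t) + 1 / cis (arccos t)) / 2 \<in> ellipse_region \<rho>"
    using assms by (intro joukowski_mem_ellipse_region) auto
  also have "(cis (arccos t) + 1 / cis (arccos t)) / 2 = complex_of_real t"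
    using assms by (subst joukowski_cis) simp
  finally show ?thesis .
qed

text \<open>At equal parameter the circles lie on the same ray from 0, so the segment joining the
  two points has moduli between \<open>r\<close> and \<open>s\<close>.\<close>

lemma homotopic_loops_part_circlepath_annulus:
  assumes "0 < a" "a < r" "r < b" "a < s" "s < b"
  shows "homotopic_loops {z. a < cmod z \<and> cmod z < b}
    (part_circlepath 0 r (-pi) pi) (part_circlepath 0 s (-pi) pi)"
proof (rule homotopic_loops_linear)
  fix t :: real
  show "closed_segment (part_circlepath 0 r (-pi) pi t) (part_circlepath 0 s (-pi) pi t)
      \<subseteq> {z. a < cmod z \<and> cmod z < b}"
  proof
    fix z assume "z \<in> closed_segment (part_circlepath 0 r (-pi) pi t) (part_circlepath 0 s (-pi) pi t)"
    then obtain u where u: "0 \<le> u" "u \<le> 1"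
      "z = (1 - u) *\<^sub>R part_circlepath 0 r (-pi) pi t + u *\<^sub>R part_circlepath 0 s (-pi) pi t"
      by (auto simp: closed_segment_def)
    define v where "v = (1 - u) * r + u * s"
    have "z = of_real v * exp (\<i> * of_real (linepath (-pi) pi t))"
      unfolding u(3) v_def part_circlepath_def by (simp add: scaleR_conv_of_real algebra_simps)
    then have "cmod z = \<bar>v\<bar>" by (simp add: norm_mult)
    \<comment> \<open>The negated instance of the convexity bound yields the lower bound
      \<open>a < v\<close>.\<close>
    moreover have "v < b" "- v < - a"
      using assms u convex_bound_lt[of r b s "1 - u" u] convex_bound_lt[of "-r" "-a" "-s" "1 - u" u]
      unfolding v_def by auto
    ultimately show "z \<in> {z. a < cmod z \<and> cmod z < b}" using assms(1) by simp
  qed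
qed (auto simp: exp_minus)

text \<open>With \<open>\<theta>\<close> read as the argument of \<open>z\<close>, the cosine
  integral is a contour integral of \<open>F\<close> over the unit circle. \<open>F\<close> is
  holomorphic in the annulus \<open>A\<close>, so the circle can be enlarged to any radius
  \<open>r < \<rho>\<close>, where \<open>F\<close> is at most
  \<open>M / r ^ (k + 1)\<close>.\<close>

lemma norm_integral_cos_le_analytic:
  fixes f :: "complex \<Rightarrow> complex"
  assumes \<rho>: "\<rho> > 1" and holo: "f holomorphic_on ellipse_region \<rho>"
    and bound: "\<And>z. z \<in> ellipse_region \<rho> \<Longrightarrow> cmod (f z) \<le> M"
  shows "cmod (integral {0..pi} (\<lambda>\<theta>. f (of_real (cos \<theta>)) * of_real (cos (real k * \<theta>)))) \<le> pi * M / \<rho> ^ k"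
proof -
  define A where "A = {z. 1 / \<rho> < cmod z \<and> cmod z < \<rho>}"
  define F where "F z = f ((z + 1 / z) / 2) / z ^ Suc k" for z
  have nz: "z \<noteq> 0" if "z \<in> A" for z
    using that \<rho> by (auto simp: A_def)
  have J: "(z + 1 / z) / 2 \<in> ellipse_region \<rho>" if "z \<in> A" for z
    using that \<rho> by (intro joukowski_mem_ellipse_region) (auto simp: A_def)
  have openA: "open A"
    unfolding A_def by (intro open_Collect_conj open_Collect_less continuous_intros)
  have M: "0 \<le> M"
    by (rule order_trans[OF norm_ge_zero bound[OF real_mem_ellipse_region[OF \<rho>, of 0]]]) simp
  have "(\<lambda>z. (z + 1 / z) / 2) holomorphic_on A"
    by (intro holomorphic_intros) (auto dest: nz)
  from holomorphic_on_compose_gen[OF this holo] have "(\<lambda>z. f ((z + 1 / z) / 2)) holomorphic_on A"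
    using J by (auto simp: o_def)
  then have F: "F holomorphic_on A"
    unfolding F_def by (intro holomorphic_intros) (auto dest: nz)
  let ?I = "integral {0..pi} (\<lambda>\<theta>. f (of_real (cos \<theta>)) * of_real (cos (real k * \<theta>)))"
  let ?P = "\<lambda>\<theta>. f (of_real (cos \<theta>)) * cis (- (real k * \<theta>))"
  have fcos: "continuous_on S (\<lambda>\<theta>. f (of_real (cos \<theta>)))" for S
    by (rule continuous_on_compose2[OF holomorphic_on_imp_continuous_on[OF holo]])
       (auto intro!: continuous_intros real_mem_ellipse_region \<rho>)
  have P_cont: "continuous_on S ?P" for S
    by (intro continuous_intros fcos)
  have P_cont': "continuous_on S (\<lambda>\<theta>. ?P (- \<theta>))" for S
    by (intro continuous_intros fcos) (use fcos in simp)
  \<comment> \<open>The parameter interval is symmetric about 0 and \<open>f (cos \<theta>)\<close>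
    is even, so folding pairs \<open>cis (- k \<theta>)\<close> with \<open>cis (k \<theta>)\<close>
    into \<open>2 cos (k \<theta>)\<close>.\<close>
  have circ: "contour_integral (part_circlepath 0 1 (-pi) pi) F = 2 * \<i> * ?I"
  proof -
    have F_cis: "F (0 + of_real 1 * cis \<theta>) * of_real 1 * \<i> * cis \<theta> = \<i> * ?P \<theta>" for \<theta>
    proof -
      have "cis (- (real k * \<theta>)) = 1 / cis \<theta> ^ k"
        by (simp add: Complex.DeMoivre divide_inverse)
      then show ?thesis using joukowski_cis[of \<theta>] by (simp add: F_def)
    qed
    have "contour_integral (part_circlepath 0 1 (-pi) pi) F = integral {-pi..pi} (\<lambda>\<theta>. \<i> * ?P \<theta>)"
      by (subst contour_integral_part_circlepath_eq) (simp_all only: F_cis pi_gt_zero, simp)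
    also have "\<dots> = \<i> * integral {-pi..pi} ?P" by simp
    also have "integral {-pi..pi} ?P = integral {-pi..0} ?P + integral {0..pi} ?P"
      by (rule Henstock_Kurzweil_Integration.integral_combine[symmetric]) (auto intro!: integrable_continuous_real P_cont)
    also have "integral {-pi..0} ?P = integral {0..pi} (\<lambda>\<theta>. ?P (- \<theta>))"
      using Henstock_Kurzweil_Integration.integral_reflect_real[of pi 0 "\<lambda>\<theta>. ?P (- \<theta>)"] by simp
    also have "integral {0..pi} (\<lambda>\<theta>. ?P (- \<theta>)) + integral {0..pi} ?P
        = integral {0..pi} (\<lambda>\<theta>. ?P (- \<theta>) + ?P \<theta>)"
      by (rule integral_add[symmetric]; intro integrable_continuous_real P_cont P_cont')
    also have "(\<lambda>\<theta>. ?P (- \<theta>) + ?P \<theta>) = (\<lambda>\<theta>. 2 * (f (of_real (cos \<theta>)) * of_real (cos (real k * \<theta>))))"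
    proof
      fix \<theta>
      have "cis (real k * \<theta>) + cis (- (real k * \<theta>)) = 2 * of_real (cos (real k * \<theta>))"
        by (simp add: complex_eq_iff)
      then show "?P (- \<theta>) + ?P \<theta> = 2 * (f (of_real (cos \<theta>)) * of_real (cos (real k * \<theta>)))"
        by (simp flip: distrib_left)
    qed
    finally show ?thesis by simp
  qed
  have le: "cmod ?I * r ^ k \<le> pi * M" if r: "1 < r" "r < \<rho>" for r
  proof -
    have pA: "path_image (part_circlepath 0 r (-pi) pi) \<subseteq> A"
      and pr: "z \<in> path_image (part_circlepath 0 r (-pi) pi) \<Longrightarrow> cmod z = r" for z
      using path_image_part_circlepath'[of 0 r "-pi" pi] r \<rho>
      by (auto simp: A_def norm_mult field_simps less_1_mult)
    have "contour_integral (part_circlepath 0 1 (-pi) pi) F = contour_integral (part_circlepath 0 r (-pi) pi) F"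
      using r \<rho> F openA homotopic_loops_part_circlepath_annulus[of "1 / \<rho>" 1 \<rho> r]
      by (intro Cauchy_theorem_homotopic_loops[of A]) (auto simp: A_def field_simps less_1_mult)
    moreover have "cmod (contour_integral (part_circlepath 0 r (-pi) pi) F) \<le> M / r ^ Suc k * r * \<bar>pi - (-pi)\<bar>"
    proof (rule contour_integral_bound_part_circlepath)
      show "F contour_integrable_on part_circlepath 0 r (- pi) pi"
        by (intro contour_integrable_continuous_part_circlepath continuous_on_subset[OF holomorphic_on_imp_continuous_on[OF F] pA])
      fix z assume z: "z \<in> path_image (part_circlepath 0 r (- pi) pi)"
      then have "cmod (f ((z + 1 / z) / 2)) \<le> M" using pA bound J by blast
      then show "cmod (F z) \<le> M / r ^ Suc k"
        unfolding F_def norm_divide norm_power pr[OF z] using r by (intro divide_right_mono) auto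
    qed (use M r in auto)
    ultimately have "cmod (2 * \<i> * ?I) \<le> M / r ^ Suc k * r * \<bar>pi - (-pi)\<bar>"
      unfolding circ by simp
    moreover have "cmod (2 * \<i> * ?I) = 2 * cmod ?I" by (simp add: norm_mult)
    ultimately have "2 * cmod ?I \<le> M / r ^ Suc k * r * \<bar>pi - (-pi)\<bar>" by simp
    then show ?thesis using r by (simp add: field_simps)
  qed
  \<comment> \<open>The annulus is open, so radius \<open>\<rho>\<close> is reached only as a limit
    from the left.\<close>
  have "cmod ?I * \<rho> ^ k \<le> pi * M"
  proof (rule tendsto_upperbound)
    show "((\<lambda>r. cmod ?I * r ^ k) \<longlongrightarrow> cmod ?I * \<rho> ^ k) (at_left \<rho>)" by (intro tendsto_intros)
    have "eventually (\<lambda>r. r \<in> {1<..<\<rho>}) (at_left \<rho>)" using \<rho> by (rule eventually_at_left_real)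
    then show "eventually (\<lambda>r. cmod ?I * r ^ k \<le> pi * M) (at_left \<rho>)"
      by eventually_elim (use le in auto)
  qed auto
  then show ?thesis using \<rho> by (simp add: field_simps)
qed

text \<open>Taking the real part after a factor \<open>c\<close> of the unit disc passes to a real
  function, as the Chebyshev estimates require, without enlarging the bound.\<close>

lemma abs_cheb_coeff_le_analytic:
  fixes f :: "complex \<Rightarrow> complex"
  assumes \<rho>: "\<rho> > 1" and holo: "f holomorphic_on ellipse_region \<rho>"
    and bound: "\<And>z. z \<in> ellipse_region \<rho> \<Longrightarrow> cmod (f z) \<le> M"
    and c: "cmod c \<le> 1"
  shows "\<bar>cheb_coeff (\<lambda>t. Re (c * f (of_real t))) k\<bar> \<le> 2 * M / \<rho> ^ k"
proof -
  let ?F = "\<lambda>\<theta>. f (of_real (cos \<theta>)) * of_real (cos (real k * \<theta>))"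
  have "continuous_on {0..pi} (\<lambda>\<theta>. f (of_real (cos \<theta>)))"
    by (rule continuous_on_compose2[OF holomorphic_on_imp_continuous_on[OF holo]])
       (auto intro!: continuous_intros real_mem_ellipse_region \<rho>)
  then have "?F integrable_on {0..pi}"
    by (intro integrable_continuous_real continuous_intros)
  then have "((\<lambda>\<theta>. Re (c * ?F \<theta>)) has_integral Re (c * integral {0..pi} ?F)) {0..pi}"
    by (intro has_integral_Re has_integral_mult_right integrable_integral)
  then have "cheb_coeff (\<lambda>t. Re (c * f (of_real t))) k = 2 / pi * Re (c * integral {0..pi} ?F)"
    unfolding cheb_coeff_def by (simp add: integral_unique algebra_simps)
  also have "\<bar>\<dots>\<bar> \<le> 2 / pi * (1 * cmod (integral {0..pi} ?F))"
    unfolding abs_mult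
    by (intro mult_mono order_trans[OF abs_Re_le_cmod]) (auto simp: norm_mult intro!: mult_left_le_one_le c)
  also have "\<dots> \<le> 2 / pi * (1 * (pi * M / \<rho> ^ k))"
    by (intro mult_left_mono norm_integral_cos_le_analytic[OF \<rho> holo bound]) auto
  finally show ?thesis by simp
qed

context gauss_quadrature begin

text \<open>A rotation \<open>c\<close> turns the modulus of the complex remainder into the
  remainder of the real function \<open>u\<close>; the tail of its coefficients is bounded by a
  geometric series with ratio \<open>1 / \<rho>\<close>.\<close>

theorem remainder_c_le_analytic:
  fixes f :: "complex \<Rightarrow> complex"
  assumes \<rho>: "\<rho> > 1" and holo: "f holomorphic_on ellipse_region \<rho>"
    and bound: "\<And>z. z \<in> ellipse_region \<rho> \<Longrightarrow> cmod (f z) \<le> M"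
  shows "cmod (remainder_c W n x w f) \<le> 4 * integral {-1..1} W * M / (\<rho> ^ (2 * n) * (1 - 1 / \<rho>))"
proof -
  \<comment> \<open>The conjugate of the phase of the remainder, so that multiplication rotates the
    remainder to its modulus. For a zero remainder \<open>sgn\<close> is 0, which is why only
    \<open>cmod c \<le> 1\<close> is claimed.\<close>
  define c where "c = cnj (sgn (remainder_c W n x w f))"
  define u where "u t = Re (c * f (of_real t))" for t
  have c: "cmod c \<le> 1" by (simp add: c_def norm_sgn)
  have M: "0 \<le> M"
    by (rule order_trans[OF norm_ge_zero bound[OF real_mem_ellipse_region[OF \<rho>, of 0]]]) simp
  have fc: "continuous_on {-1..1} (\<lambda>t. f (of_real t))"
    by (rule continuous_on_compose2[OF holomorphic_on_imp_continuous_on[OF holo]])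
       (auto intro!: continuous_intros real_mem_ellipse_region \<rho>)
  have "((\<lambda>t. Re (c * (f (of_real t) * of_real (W t)))) has_integral
      Re (c * integral {-1..1} (\<lambda>t. f (of_real t) * of_real (W t)))) {-1..1}"
    by (intro has_integral_Re has_integral_mult_right integrable_integral integrable_continuous_real continuous_intros fc W_cont)
  then have "remainder_r W n x w u = Re (c * remainder_c W n x w f)"
    unfolding remainder_r_def remainder_c_def u_def
    by (simp add: integral_unique sum_distrib_left algebra_simps)
  also have "c * remainder_c W n x w f = of_real (cmod (remainder_c W n x w f))"
    unfolding c_def sgn_div_norm
    by (simp add: scaleR_conv_of_real complex_norm_square[symmetric] power2_eq_square divide_simps mult.commute)
  finally have "cmod (remainder_c W n x w f) = \<bar>remainder_r W n x w u\<bar>" by simp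
  also have "\<dots> \<le> 2 * integral {-1..1} W * (2 * M / (\<rho> ^ (2 * n) * (1 - 1 / \<rho>)))"
  proof (rule remainder_le_cheb_tail)
    show "continuous_on {-1..1} u" unfolding u_def by (intro continuous_intros fc)
    fix N
    have geo: "(\<Sum>k<m. (1 / \<rho>) ^ k) \<le> 1 / (1 - 1 / \<rho>)" for m
      using sum_le_suminf[of "\<lambda>k. (1 / \<rho>) ^ k" "{..<m}"] suminf_geometric[of "1 / \<rho>"] \<rho>
      by (simp add: summable_geometric)
    have "(\<Sum>k=2*n..<N. \<bar>cheb_coeff u k\<bar>) \<le> (\<Sum>k=2*n..<N. 2 * M / \<rho> ^ k)"
      unfolding u_def by (intro sum_mono abs_cheb_coeff_le_analytic[OF \<rho> holo bound c])
    \<comment> \<open>Reindexing from \<open>2 * n\<close>; both sums are empty if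
      \<open>N < 2 * n\<close>.\<close>
    also have "\<dots> = (\<Sum>k<N - 2*n. 2 * M / \<rho> ^ (2*n) * (1 / \<rho>) ^ k)"
      using sum.shift_bounds_nat_ivl[of "\<lambda>k. 2 * M / \<rho> ^ k" 0 "2*n" "N - 2*n"]
      by (cases "2 * n \<le> N") (auto simp: lessThan_atLeast0 power_add power_divide mult_ac)
    also have "\<dots> \<le> 2 * M / \<rho> ^ (2*n) * (1 / (1 - 1 / \<rho>))"
      unfolding sum_distrib_left[symmetric] using M \<rho> by (intro mult_left_mono geo) auto
    finally show "(\<Sum>k=2*n..<N. \<bar>cheb_coeff u k\<bar>) \<le> 2 * M / (\<rho> ^ (2*n) * (1 - 1 / \<rho>))" by simp
  qed
  finally show ?thesis by (simp add: mult_ac)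
qed

end

subsection \<open>Absolutely continuous functions and functions of bounded variation\<close>

text \<open>Division intervals may share endpoints, so the union is taken over their interiors,
  which are disjoint and have the same lengths.\<close>

lemma sum_tagged_lengths_le_measure:
  fixes p :: "(real \<times> real set) set"
  assumes p: "p tagged_division_of {a..b}" and q: "q \<subseteq> p"
    and U: "U \<in> lmeasurable" "\<And>z. z \<in> q \<Longrightarrow> snd z \<subseteq> U"
  shows "(\<Sum>z\<in>q. measure lborel (snd z)) \<le> measure lebesgue U"
proof -
  have fin: "finite q" using p q finite_subset tagged_division_of_finite by blast
  have K: "\<exists>c d. snd z = {c..d}" if "z \<in> q" for z
    using tagged_division_ofD(4)[OF p, of "fst z" "snd z"] q that by auto
  have "measure lborel (snd z) = measure lebesgue (interior (snd z))" if z: "z \<in> q" for z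
  proof -
    obtain c d where "snd z = {c..d}" using K[OF z] by blast
    then show ?thesis by (cases "c \<le> d") (auto simp: interior_atLeastAtMost_real)
  qed
  then have "(\<Sum>z\<in>q. measure lborel (snd z)) = (\<Sum>z\<in>q. measure lebesgue (interior (snd z)))"
    by (intro sum.cong) auto
  also have "\<dots> = measure lebesgue (\<Union>z\<in>q. interior (snd z))"
  proof (rule measure_UNION'[symmetric])
    show "interior (snd z) \<in> lmeasurable" if "z \<in> q" for z
      using K[OF that] by (auto simp: interior_atLeastAtMost_real)
    show "pairwise (\<lambda>z z'. disjnt (interior (snd z)) (interior (snd z'))) q"
      unfolding pairwise_def disjnt_def
      using tagged_division_ofD(5)[OF p] q by (metis prod.collapse subsetD)
  qed (rule fin)
  also have "\<dots> \<le> measure lebesgue U"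
  proof (rule measure_mono_fmeasurable)
    show "(\<Union>z\<in>q. interior (snd z)) \<subseteq> U" using U(2) interior_subset by fast
    show "(\<Union>z\<in>q. interior (snd z)) \<in> sets lebesgue" 
      by (simp add: borel_open open_UN)
  qed (rule U)
  finally show ?thesis .
qed

text \<open>The gauge forces intervals tagged in the exceptional null set into an open set of small measure,
  where absolute continuity bounds the increments of \<open>f\<close>; the others are controlled by the derivative.\<close>
lemma abs_continuous_on_imp_has_integral:
  assumes ac: "abs_continuous_on a b f" and ab: "a \<le> b"
    and deriv: "AE t in lebesgue. t \<in> {a<..<b} \<longrightarrow> (f has_real_derivative h t) (at t)"
  shows "(h has_integral (f b - f a)) {a..b}"
proof -
  obtain N0 where N0': "\<And>t. t \<in> space lebesgue - N0 \<Longrightarrow>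
      t \<in> {a<..<b} \<longrightarrow> (f has_real_derivative h t) (at t)"
    and null0: "N0 \<in> null_sets lebesgue"
    using deriv by (rule AE_E3) blast
  have N0: "(f has_real_derivative h t) (at t)" if "t \<notin> N0" "t \<in> {a<..<b}" for t
    using N0'[of t] that by simp
  \<comment> \<open>The endpoints join the null set, since the derivative is given only in the open
    interval.\<close>
  define N where "N = N0 \<union> {a, b}"
  have null: "N \<in> null_sets lebesgue"
    unfolding N_def using null0 by (intro null_sets.Un) (auto simp flip: negligible_iff_null_sets)
  have N: "(f has_real_derivative h t) (at t)" if "t \<in> {a..b}" "t \<notin> N" for t
    using that by (intro N0) (auto simp: N_def)
  \<comment> \<open>Setting the derivative to 0 on the null set leaves the integral unchanged and
    reduces intervals tagged there to the bare increments of \<open>f\<close>.\<close>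
  define h0 where "h0 t = (if t \<in> N then 0 else h t)" for t
  have "(h0 has_integral (f b - f a)) {a..b}"
    unfolding has_integral_real
  proof (intro allI impI)
    fix e :: real assume e: "e > 0"
    \<comment> \<open>Gives \<open>e1 * (b - a) \<le> e / 2\<close>, the share of the intervals
      tagged outside \<open>N\<close>; the \<open>+ 1\<close> covers \<open>a = b\<close>.\<close>
    define e1 where "e1 = e / (2 * (b - a + 1))"
    have e1: "e1 > 0" using e ab by (simp add: e1_def)
    have "e / 2 > 0" using e by simp
    from ac[unfolded abs_continuous_on_def, THEN spec, THEN mp, OF this] obtain \<delta> where \<delta>: "\<delta> > 0"
      and ac0: "\<forall>(n::nat) (l::nat \<Rightarrow> real) (r::nat \<Rightarrow> real).
        (\<forall>i<n. a \<le> l i \<and> l i \<le> r i \<and> r i \<le> b) \<and>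
        (\<forall>i<n. \<forall>j<n. i \<noteq> j \<longrightarrow> r i \<le> l j \<or> r j \<le> l i) \<and>
        (\<Sum>i<n. r i - l i) < \<delta> \<longrightarrow> (\<Sum>i<n. \<bar>f (r i) - f (l i)\<bar>) < e / 2"
      by (elim exE conjE) (rule that)
    note ac\<delta> = ac0[THEN spec, THEN spec, THEN spec, THEN mp, OF conjI, OF _ conjI]
    \<comment> \<open>The intervals tagged in \<open>N\<close> will lie inside \<open>U\<close>, so
      their total length stays below the \<open>\<delta>\<close> of absolute continuity.\<close>
    obtain U where U: "open U" "N \<subseteq> U" "U - N \<in> lmeasurable" "emeasure lebesgue (U - N) < ennreal \<delta>"
      using sets_lebesgue_outer_open[of N \<delta>] null \<delta> by blast
    have UN: "U = (U - N) \<union> N" using U(2) by blast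
    have U_meas: "U \<in> lmeasurable"
      by (subst UN) (intro fmeasurable.Un U(3) fmeasurableI_null_sets null)
    have "emeasure lebesgue U < ennreal \<delta>"
      using null U_meas U(4) by (simp add: emeasure_Diff_null_set fmeasurableD)
    then have U_small: "measure lebesgue U < \<delta>"
      unfolding emeasure_eq_measure2[OF U_meas] by (simp add: ennreal_less_iff)
    have "\<exists>d>0. (t \<in> N \<longrightarrow> ball t d \<subseteq> U) \<and>
        (t \<in> {a..b} - N \<longrightarrow> (\<forall>y. \<bar>y - t\<bar> < d \<longrightarrow> \<bar>f y - f t - h t * (y - t)\<bar> \<le> e1 * \<bar>y - t\<bar>))" for t
    proof (cases "t \<in> N")
      case True
      then show ?thesis using U(1,2) open_contains_ball by blast
    next
      case False
      show ?thesis
      proof (cases "t \<in> {a..b}")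
        case True
        from N[OF this False] have "\<exists>d>0. \<forall>y. \<bar>y - t\<bar> < d \<longrightarrow> \<bar>f y - f t - h t * (y - t)\<bar> \<le> e1 * \<bar>y - t\<bar>"
          using e1 unfolding has_field_derivative_def has_derivative_within_alt by simp
        then show ?thesis using False by blast
      next
        case out: False
        then show ?thesis using False by (intro exI[of _ 1]) auto
      qed
    qed
    then obtain d where d0: "\<And>t. d t > 0" and dN: "\<And>t. t \<in> N \<Longrightarrow> ball t (d t) \<subseteq> U"
      and dd: "\<And>t y. t \<in> {a..b} - N \<Longrightarrow> \<bar>y - t\<bar> < d t \<Longrightarrow> \<bar>f y - f t - h t * (y - t)\<bar> \<le> e1 * \<bar>y - t\<bar>"
      by metis
    show "\<exists>\<gamma>. gauge \<gamma> \<and> (\<forall>p. p tagged_division_of {a..b} \<and> \<gamma> fine p \<longrightarrow>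
        norm ((\<Sum>(x, k)\<in>p. measure lborel k *\<^sub>R h0 x) - (f b - f a)) < e)"
    proof (intro exI conjI allI impI)
      show "gauge (\<lambda>t. ball t (d t))" using d0 by (simp add: gauge_def)
      fix p assume "p tagged_division_of {a..b} \<and> (\<lambda>t. ball t (d t)) fine p"
      then have p: "p tagged_division_of {a..b}" and fine: "(\<lambda>t. ball t (d t)) fine p" by auto
      define l r where "l z = Inf (snd z)" and "r z = Sup (snd z)" for z :: "real \<times> real set"
      have fin: "finite p" using p by blast
      have K: "snd z = {l z..r z}" "l z \<le> fst z" "fst z \<le> r z" "measure lborel (snd z) = r z - l z"
        "a \<le> l z" "r z \<le> b" "{l z..r z} \<subseteq> ball (fst z) (d (fst z))" if z: "z \<in> p" for z
      proof -
        have zp: "(fst z, snd z) \<in> p" using z by simp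
        obtain u v where uv: "snd z = {u..v}"
          using tagged_division_ofD(4)[OF p zp] by auto
        have mem: "fst z \<in> snd z" "snd z \<subseteq> {a..b}"
          using tagged_division_ofD(2,3)[OF p zp] by auto
        then have "u \<le> v" "l z = u" "r z = v" using uv by (auto simp: l_def r_def)
        then show "snd z = {l z..r z}" "l z \<le> fst z" "fst z \<le> r z" "measure lborel (snd z) = r z - l z"
          "a \<le> l z" "r z \<le> b"
          using uv mem by auto
        then show "{l z..r z} \<subseteq> ball (fst z) (d (fst z))"
          using fine zp unfolding fine_def by (metis (no_types, lifting) case_prodD)
      qed
      define D where "D z = measure lborel (snd z) * h0 (fst z) - (f (r z) - f (l z))" for z
      \<comment> \<open>Degenerate intervals are left out: for the others, disjoint interiors give
        the ordering of endpoints that absolute continuity asks for. The degenerate ones contribute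
        0.\<close>
      define q where "q = {z \<in> p. fst z \<in> N \<and> l z < r z}"
      have qp: "q \<subseteq> p" by (auto simp: q_def)
      have finq: "finite q" using finite_subset[OF qp fin] .
      have "(\<Sum>z\<in>p. f (r z) - f (l z)) = f b - f a"
        using additive_tagged_division_1[OF ab p, of f] by (simp add: l_def r_def case_prod_unfold)
      then have eq: "(\<Sum>(x, k)\<in>p. measure lborel k *\<^sub>R h0 x) - (f b - f a) = (\<Sum>z\<in>p. D z)"
        unfolding D_def by (simp add: sum_subtractf case_prod_unfold)
      have "(\<Sum>z\<in>q. \<bar>D z\<bar>) < e / 2"
      proof -
        obtain g where g: "bij_betw g {..<card q} q"
          using ex_bij_betw_nat_finite[OF finq] by (auto simp: atLeast0LessThan)
        have gq: "g i \<in> q" if "i < card q" for i using g that by (auto simp: bij_betw_def)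
        have "(\<Sum>i<card q. \<bar>f (r (g i)) - f (l (g i))\<bar>) < e / 2"
        proof (rule ac\<delta>)
          show "\<forall>i<card q. a \<le> l (g i) \<and> l (g i) \<le> r (g i) \<and> r (g i) \<le> b"
            using gq K qp by (metis order_trans subsetD)
          show "\<forall>i<card q. \<forall>j<card q. i \<noteq> j \<longrightarrow> r (g i) \<le> l (g j) \<or> r (g j) \<le> l (g i)"
          proof (intro allI impI)
            fix i j assume ij: "i < card q" "j < card q" "i \<noteq> j"
            then have "g i \<noteq> g j" using g by (auto simp: bij_betw_def inj_on_def)
            then have "interior (snd (g i)) \<inter> interior (snd (g j)) = {}"
              using tagged_division_ofD(5)[OF p] gq ij qp by (metis prod.collapse subsetD)
            then have "{l (g i)<..<r (g i)} \<inter> {l (g j)<..<r (g j)} = {}"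
              using K(1) gq ij qp by (metis interior_atLeastAtMost_real subsetD)
            moreover have "l (g i) < r (g i)" "l (g j) < r (g j)" using gq ij by (auto simp: q_def)
            \<comment> \<open>The midpoint of an overlap would lie in both open intervals.\<close>
            moreover have "(max (l (g i)) (l (g j)) + min (r (g i)) (r (g j))) / 2
                \<in> {l (g i)<..<r (g i)} \<inter> {l (g j)<..<r (g j)}"
              if "\<not> (r (g i) \<le> l (g j) \<or> r (g j) \<le> l (g i))"
              using that \<open>l (g i) < r (g i)\<close> \<open>l (g j) < r (g j)\<close> by (auto simp: max_def min_def)
            ultimately show "r (g i) \<le> l (g j) \<or> r (g j) \<le> l (g i)" by blast
          qed
          have "(\<Sum>i<card q. r (g i) - l (g i)) = (\<Sum>z\<in>q. r z - l z)"
            by (rule sum.reindex_bij_betw[OF g])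
          also have "\<dots> = (\<Sum>z\<in>q. measure lborel (snd z))" using K(4) qp by (intro sum.cong) auto
          also have "\<dots> \<le> measure lebesgue U"
          proof (rule sum_tagged_lengths_le_measure[OF p qp U_meas])
            show "snd z \<subseteq> U" if "z \<in> q" for z
              using K(1,7)[of z] dN[of "fst z"] that by (auto simp: q_def)
          qed
          finally show "(\<Sum>i<card q. r (g i) - l (g i)) < \<delta>" using U_small by simp
        qed
        also have "(\<Sum>i<card q. \<bar>f (r (g i)) - f (l (g i))\<bar>) = (\<Sum>z\<in>q. \<bar>f (r z) - f (l z)\<bar>)"
          by (rule sum.reindex_bij_betw[OF g])
        also have "\<dots> = (\<Sum>z\<in>q. \<bar>D z\<bar>)"
          by (intro sum.cong) (auto simp: D_def q_def h0_def)
        finally show ?thesis .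
      qed
      moreover have "(\<Sum>z\<in>p - q. \<bar>D z\<bar>) \<le> e / 2"
      proof -
        have "\<bar>D z\<bar> \<le> e1 * measure lborel (snd z)" if z: "z \<in> p - q" for z
        proof (cases "fst z \<in> N")
          case True
          then have "l z = r z" using z K(2,3)[of z] by (auto simp: q_def)
          then show ?thesis using z K(4)[of z] by (simp add: D_def)
        next
          case False
          have zp: "z \<in> p" using z by simp
          let ?x = "fst z"
          have x: "?x \<in> {a..b} - N" using K(2,3,5,6)[OF zp] False by auto
          have "r z \<in> ball ?x (d ?x)" "l z \<in> ball ?x (d ?x)"
            using K(2,3)[OF zp] by (auto intro!: subsetD[OF K(7)[OF zp]] simp del: mem_ball)
          then have "\<bar>r z - ?x\<bar> < d ?x" "\<bar>l z - ?x\<bar> < d ?x"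
            by (auto simp: dist_real_def abs_minus_commute)
          note dd[OF x this(1)] dd[OF x this(2)]
          \<comment> \<open>The increment is split at the tag, so the derivative estimate applies at
            both ends and the errors add up to \<open>e1\<close> times the length.\<close>
          moreover have "D z = - (f (r z) - f ?x - h ?x * (r z - ?x)) + (f (l z) - f ?x - h ?x * (l z - ?x))"
            unfolding D_def K(4)[OF zp] using False by (simp add: h0_def algebra_simps)
          ultimately have "\<bar>D z\<bar> \<le> e1 * (r z - ?x) + e1 * (?x - l z)"
            using K(2,3)[OF zp] by (simp add: abs_le_iff)
          then show ?thesis unfolding K(4)[OF zp] by (simp add: algebra_simps)
        qed
        then have "(\<Sum>z\<in>p - q. \<bar>D z\<bar>) \<le> (\<Sum>z\<in>p - q. e1 * measure lborel (snd z))" by (rule sum_mono)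
        also have "\<dots> \<le> (\<Sum>z\<in>p. e1 * measure lborel (snd z))"
          using e1 fin by (intro sum_mono2) auto
        also have "\<dots> = e1 * (b - a)"
          using additive_content_tagged_division[of p a b] p ab
          by (simp add: case_prod_unfold sum_distrib_left[symmetric])
        also have "\<dots> \<le> e / 2" using e ab by (simp add: e1_def field_simps)
        finally show ?thesis .
      qed
      moreover have "\<bar>\<Sum>z\<in>p. D z\<bar> \<le> (\<Sum>z\<in>q. \<bar>D z\<bar>) + (\<Sum>z\<in>p - q. \<bar>D z\<bar>)"
        using sum_abs[of D p] sum.subset_diff[OF qp fin, of "\<lambda>z. \<bar>D z\<bar>"] by simp
      ultimately show "norm ((\<Sum>(x, k)\<in>p. measure lborel k *\<^sub>R h0 x) - (f b - f a)) < e"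
        unfolding eq by simp
    qed
  qed
  then show ?thesis
    by (rule has_integral_spike[of N, rotated 2]) (use null in \<open>auto simp: h0_def negligible_iff_null_sets\<close>)
qed

section \<open>Total variation and the Jordan decomposition\<close>

lemma variation_sums_extend:
  assumes "S \<in> variation_sums a s f" "s \<le> t"
  shows "S + \<bar>f t - f s\<bar> \<in> variation_sums a t f"
proof -
  obtain n \<tau> where S: "S = (\<Sum>i<n. \<bar>f (\<tau> (Suc i)) - f (\<tau> i)\<bar>)" "\<tau> 0 = a" "\<tau> n = s" "\<forall>i<n. \<tau> i \<le> \<tau> (Suc i)"
    using assms(1) unfolding variation_sums_def mem_Collect_eq by (elim exE conjE) (rule that)
  let ?\<tau> = "\<tau>(Suc n := t)"
  have "(\<Sum>i<n. \<bar>f (?\<tau> (Suc i)) - f (?\<tau> i)\<bar>) = S"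
    unfolding S(1) by (intro sum.cong) auto
  then have "S + \<bar>f t - f s\<bar> = (\<Sum>i<Suc n. \<bar>f (?\<tau> (Suc i)) - f (?\<tau> i)\<bar>)"
    using S(3) by simp
  moreover have "?\<tau> 0 = a" "?\<tau> (Suc n) = t" "\<forall>i<Suc n. ?\<tau> i \<le> ?\<tau> (Suc i)"
    using S assms(2) by (auto simp: less_Suc_eq)
  ultimately show ?thesis
    unfolding variation_sums_def mem_Collect_eq by (intro exI[of _ "Suc n"] exI[of _ ?\<tau>] conjI)
qed

lemma zero_mem_variation_sums: "0 \<in> variation_sums a a f"
  unfolding variation_sums_def mem_Collect_eq by (intro exI[of _ "0::nat"] exI[of _ "\<lambda>_. a"]) simp

lemma variation_sums_nonempty: "a \<le> t \<Longrightarrow> variation_sums a t f \<noteq> {}"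
  using variation_sums_extend[OF zero_mem_variation_sums] by blast

lemma variation_sums_bdd_above:
  assumes "bounded_variation_on a b f" "t \<le> b"
  shows "bdd_above (variation_sums a t f)"
proof -
  obtain B where "\<And>S. S \<in> variation_sums a b f \<Longrightarrow> S \<le> B"
    using assms(1) unfolding bounded_variation_on_def bdd_above_def by blast
  then have "S \<le> B" if "S \<in> variation_sums a t f" for S
    using variation_sums_extend[OF that assms(2)] by fastforce
  then show ?thesis by (rule bdd_aboveI)
qed

text \<open>Appending \<open>t\<close> to a partition of \<open>[a, s]\<close> adds the last
  increment. This makes the running variation plus or minus \<open>f\<close> nondecreasing.\<close>

lemma total_variation_add_le:
  assumes "bounded_variation_on a b f" "a \<le> s" "s \<le> t" "t \<le> b"
  shows "total_variation a s f + \<bar>f t - f s\<bar> \<le> total_variation a t f"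
proof -
  have "total_variation a s f \<le> total_variation a t f - \<bar>f t - f s\<bar>"
    unfolding total_variation_def
  proof (rule cSup_least)
    show "variation_sums a s f \<noteq> {}" using assms by (intro variation_sums_nonempty)
    fix S assume "S \<in> variation_sums a s f"
    then have "S + \<bar>f t - f s\<bar> \<le> Sup (variation_sums a t f)"
      using assms by (intro cSup_upper variation_sums_extend variation_sums_bdd_above[of a b])
    then show "S \<le> Sup (variation_sums a t f) - \<bar>f t - f s\<bar>" by simp
  qed
  then show ?thesis by simp
qed

text \<open>The parts are half the sum and half the difference of the running variation and
  \<open>f\<close>. Their rises add up to the variation over \<open>[a, b]\<close> minus its
  nonnegative value at \<open>a\<close>.\<close>

lemma bounded_variation_jordan:
  assumes bv: "bounded_variation_on a b f" and ab: "a \<le> b"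
  obtains p q where "mono_on {a..b} p" "mono_on {a..b} q" "f = (\<lambda>t. p t - q t)"
    "(p b - p a) + (q b - q a) \<le> total_variation a b f"
proof
  let ?v = "\<lambda>t. total_variation a t f"
  let ?p = "\<lambda>t. (?v t + f t) / 2" and ?q = "\<lambda>t. (?v t - f t) / 2"
  show "mono_on {a..b} ?p" "mono_on {a..b} ?q"
    using total_variation_add_le[OF bv] by (force intro!: mono_onI simp: abs_le_iff)+
  show "f = (\<lambda>t. ?p t - ?q t)" by (auto simp: field_simps)
  have "0 \<le> ?v a"
    unfolding total_variation_def
    by (intro cSup_upper zero_mem_variation_sums variation_sums_bdd_above[OF bv ab])
  then show "(?p b - ?p a) + (?q b - ?q a) \<le> ?v b" by (simp add: field_simps)
qed

text \<open>The Jordan decomposition reduces this to monotone functions. Countability is what later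
  survives the substitution \<open>t = cos \<theta>\<close>.\<close>

lemma bounded_variation_countable_discont:
  assumes bv: "bounded_variation_on a b f" and ab: "a \<le> b"
  shows "countable {t \<in> {a..b}. \<not> continuous (at t within {a..b}) f}"
proof -
  obtain p q where pq: "mono_on {a..b} p" "mono_on {a..b} q" "f = (\<lambda>t. p t - q t)"
    by (rule bounded_variation_jordan[OF bv ab])
  have "continuous (at t within {a..b}) f"
    if "continuous (at t within {a..b}) p" "continuous (at t within {a..b}) q" for t
    unfolding pq(3) using that by (rule continuous_diff)
  then have "{t \<in> {a..b}. \<not> continuous (at t within {a..b}) f} \<subseteq>
      {t \<in> {a..b}. \<not> continuous (at t within {a..b}) p} \<union> {t \<in> {a..b}. \<not> continuous (at t within {a..b}) q}"
    by blast
  then show ?thesis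
    by (rule countable_subset) (intro countable_Un mono_on_ctble_discont pq)
qed

lemma bounded_variation_bounded:
  assumes bv: "bounded_variation_on a b f" and t: "t \<in> {a..b}"
  shows "\<bar>f t\<bar> \<le> \<bar>f a\<bar> + total_variation a b f"
proof -
  have "0 \<le> total_variation a a f"
    unfolding total_variation_def
    by (intro cSup_upper zero_mem_variation_sums variation_sums_bdd_above[OF bv]) (use t in auto)
  then show ?thesis
    using total_variation_add_le[OF bv, of a t] total_variation_add_le[OF bv, of t b] t by auto
qed

text \<open>The second mean value theorem replaces the monotone factor by its two end values,
  leaving integrals of \<open>cos (k \<theta>)\<close> over \<open>[0, c]\<close> and
  \<open>[c, pi]\<close>; it also yields integrability. The minus sign makes the factor
  nondecreasing, as \<open>cos\<close> decreases on \<open>[0, pi]\<close>.\<close>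

lemma mono_cos_has_integral:
  fixes p :: "real \<Rightarrow> real"
  assumes p: "mono_on {-1..1} p"
  shows "\<exists>I. ((\<lambda>\<theta>. p (cos \<theta>) * cos (real k * \<theta>)) has_integral I) {0..pi} \<and>
    (k > 0 \<longrightarrow> \<bar>I\<bar> \<le> (p 1 - p (-1)) / real k)"
proof -
  let ?c = "\<lambda>\<theta>. cos (real k * \<theta>)"
  have mono: "- p (cos \<theta>) \<le> - p (cos \<phi>)" if "0 \<le> \<theta>" "\<theta> \<le> \<phi>" "\<phi> \<le> pi" for \<theta> \<phi>
    using that by (auto intro!: mono_onD[OF p] cos_monotone_0_pi_le)
  obtain c where c: "c \<in> {0..pi}" and I: "((\<lambda>\<theta>. - p (cos \<theta>) * ?c \<theta>) has_integral
      (- p (cos 0) * integral {0..c} ?c + - p (cos pi) * integral {c..pi} ?c)) {0..pi}"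
    by (rule second_mean_value_theorem_full[of ?c 0 pi "\<lambda>\<theta>. - p (cos \<theta>)"])
       (use mono in \<open>auto intro!: integrable_continuous_real continuous_intros\<close>)
  let ?I = "p 1 * integral {0..c} ?c + p (-1) * integral {c..pi} ?c"
  have "((\<lambda>\<theta>. p (cos \<theta>) * ?c \<theta>) has_integral ?I) {0..pi}"
    using has_integral_neg[OF I] by (simp add: add.commute)
  moreover have "\<bar>?I\<bar> \<le> (p 1 - p (-1)) / real k" if k: "k > 0"
  proof -
    have int: "integral {u..v} ?c = (sin (real k * v) - sin (real k * u)) / real k" if "u \<le> v" for u v
    proof -
      have "(?c has_integral (sin (real k * v) / real k - sin (real k * u) / real k)) {u..v}"
        using that k by (intro fundamental_theorem_of_calculus)
          (auto intro!: derivative_eq_intros simp flip: has_real_derivative_iff_has_vector_derivative)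
      then show ?thesis by (simp add: integral_unique diff_divide_distrib)
    qed
    \<comment> \<open>As \<open>sin (k pi) = 0\<close>, the two integrals are opposite and the end
      values combine into their difference.\<close>
    have "?I = (p 1 - p (-1)) * (sin (real k * c) / real k)"
    proof -
      have "integral {0..c} ?c = sin (real k * c) / real k" "integral {c..pi} ?c = - sin (real k * c) / real k"
        using c by (simp_all add: int)
      then show ?thesis by (simp add: algebra_simps diff_divide_distrib)
    qed
    also have "\<bar>\<dots>\<bar> = (p 1 - p (-1)) * (\<bar>sin (real k * c)\<bar> / real k)"
      using mono_onD[OF p, of "-1" 1] by (simp add: abs_mult)
    also have "\<dots> \<le> (p 1 - p (-1)) * (1 / real k)"
      using mono_onD[OF p, of "-1" 1] by (intro mult_left_mono divide_right_mono) auto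
    finally show ?thesis by simp
  qed
  ultimately show ?thesis by blast
qed

text \<open>The monotone case applies to both Jordan parts, whose rises add up to at most the total
  variation.\<close>

lemma bounded_variation_cos_integral:
  assumes bv: "bounded_variation_on (-1) 1 f"
  shows "(\<lambda>\<theta>. f (cos \<theta>) * cos (real k * \<theta>)) integrable_on {0..pi}"
    and "k > 0 \<Longrightarrow> \<bar>integral {0..pi} (\<lambda>\<theta>. f (cos \<theta>) * cos (real k * \<theta>))\<bar> \<le> total_variation (-1) 1 f / real k"
proof -
  obtain p q where pq: "mono_on {-1..1} p" "mono_on {-1..1} q" "f = (\<lambda>t. p t - q t)"
    and V: "(p 1 - p (-1)) + (q 1 - q (-1)) \<le> total_variation (-1) 1 f"
    by (rule bounded_variation_jordan[OF bv]) simp_all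
  from mono_cos_has_integral[OF pq(1), of k]
  obtain I where I: "((\<lambda>\<theta>. p (cos \<theta>) * cos (real k * \<theta>)) has_integral I) {0..pi}"
      "k > 0 \<longrightarrow> \<bar>I\<bar> \<le> (p 1 - p (-1)) / real k"
    by (elim exE conjE)
  from mono_cos_has_integral[OF pq(2), of k]
  obtain J where J: "((\<lambda>\<theta>. q (cos \<theta>) * cos (real k * \<theta>)) has_integral J) {0..pi}"
      "k > 0 \<longrightarrow> \<bar>J\<bar> \<le> (q 1 - q (-1)) / real k"
    by (elim exE conjE)
  have IJ: "((\<lambda>\<theta>. f (cos \<theta>) * cos (real k * \<theta>)) has_integral I - J) {0..pi}"
    using has_integral_diff[OF I(1) J(1)] unfolding pq(3) by (simp add: left_diff_distrib)
  then show "(\<lambda>\<theta>. f (cos \<theta>) * cos (real k * \<theta>)) integrable_on {0..pi}" by blast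
  assume k: "k > 0"
  have "\<bar>I - J\<bar> \<le> (p 1 - p (-1)) / real k + (q 1 - q (-1)) / real k" using I(2) J(2) k by auto
  also have "\<dots> \<le> total_variation (-1) 1 f / real k"
    using V by (simp add: divide_right_mono flip: add_divide_distrib)
  finally show "\<bar>integral {0..pi} (\<lambda>\<theta>. f (cos \<theta>) * cos (real k * \<theta>))\<bar> \<le> total_variation (-1) 1 f / real k"
    using integral_unique[OF IJ] by simp
qed

subsection \<open>Chebyshev coefficients of integrands of finite smoothness\<close>

lemma abs_continuous_on_subinterval:
  assumes "abs_continuous_on a b f" "a \<le> c" "d \<le> b"
  shows "abs_continuous_on c d f"
  unfolding abs_continuous_on_def
proof (intro allI impI)
  fix e :: real assume "e > 0"
  from assms(1)[unfolded abs_continuous_on_def, THEN spec, THEN mp, OF this]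
  obtain \<delta> where \<delta>: "\<delta> > 0" and ac: "\<forall>(n::nat) (l::nat \<Rightarrow> real) (r::nat \<Rightarrow> real).
        (\<forall>i<n. a \<le> l i \<and> l i \<le> r i \<and> r i \<le> b) \<and>
        (\<forall>i<n. \<forall>j<n. i \<noteq> j \<longrightarrow> r i \<le> l j \<or> r j \<le> l i) \<and>
        (\<Sum>i<n. r i - l i) < \<delta> \<longrightarrow> (\<Sum>i<n. \<bar>f (r i) - f (l i)\<bar>) < e"
    by (elim exE conjE) (rule that)
  show "\<exists>\<delta>>0. \<forall>(n::nat) (l::nat \<Rightarrow> real) (r::nat \<Rightarrow> real).
        (\<forall>i<n. c \<le> l i \<and> l i \<le> r i \<and> r i \<le> d) \<and>
        (\<forall>i<n. \<forall>j<n. i \<noteq> j \<longrightarrow> r i \<le> l j \<or> r j \<le> l i) \<and>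
        (\<Sum>i<n. r i - l i) < \<delta> \<longrightarrow> (\<Sum>i<n. \<bar>f (r i) - f (l i)\<bar>) < e"
  proof (intro exI[of _ \<delta>] conjI \<delta> allI impI)
    fix n :: nat and l r :: "nat \<Rightarrow> real"
    assume *: "(\<forall>i<n. c \<le> l i \<and> l i \<le> r i \<and> r i \<le> d) \<and>
        (\<forall>i<n. \<forall>j<n. i \<noteq> j \<longrightarrow> r i \<le> l j \<or> r j \<le> l i) \<and> (\<Sum>i<n. r i - l i) < \<delta>"
    have "\<forall>i<n. a \<le> l i \<and> l i \<le> r i \<and> r i \<le> b"
      using * assms(2,3) by (meson order_trans)
    with * show "(\<Sum>i<n. \<bar>f (r i) - f (l i)\<bar>) < e"
      by (intro ac[THEN spec, THEN spec, THEN spec, THEN mp] conjI) (elim conjE, assumption)+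
  qed
qed

lemma abs_continuous_on_lipschitz:
  assumes L: "0 \<le> L" and lip: "\<And>s t. s \<in> {a..b} \<Longrightarrow> t \<in> {a..b} \<Longrightarrow> \<bar>f s - f t\<bar> \<le> L * \<bar>s - t\<bar>"
  shows "abs_continuous_on a b f"
  unfolding abs_continuous_on_def
proof (intro allI impI)
  fix e :: real assume e: "e > 0"
  show "\<exists>\<delta>>0. \<forall>(n::nat) (l::nat \<Rightarrow> real) (r::nat \<Rightarrow> real).
        (\<forall>i<n. a \<le> l i \<and> l i \<le> r i \<and> r i \<le> b) \<and>
        (\<forall>i<n. \<forall>j<n. i \<noteq> j \<longrightarrow> r i \<le> l j \<or> r j \<le> l i) \<and>
        (\<Sum>i<n. r i - l i) < \<delta> \<longrightarrow> (\<Sum>i<n. \<bar>f (r i) - f (l i)\<bar>) < e"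
  \<comment> \<open>\<open>L + 1\<close> keeps the quotient meaningful for \<open>L = 0\<close> and
    makes \<open>L * (e / (L + 1)) < e\<close> strict.\<close>
  proof (intro exI[of _ "e / (L + 1)"] conjI allI impI)
    show "e / (L + 1) > 0" using e L by simp
    fix n :: nat and l r :: "nat \<Rightarrow> real"
    assume *: "(\<forall>i<n. a \<le> l i \<and> l i \<le> r i \<and> r i \<le> b) \<and>
        (\<forall>i<n. \<forall>j<n. i \<noteq> j \<longrightarrow> r i \<le> l j \<or> r j \<le> l i) \<and> (\<Sum>i<n. r i - l i) < e / (L + 1)"
    have "(\<Sum>i<n. \<bar>f (r i) - f (l i)\<bar>) \<le> (\<Sum>i<n. L * (r i - l i))"
    proof (rule sum_mono)
      fix i assume "i \<in> {..<n}"
      then have "a \<le> l i" "l i \<le> r i" "r i \<le> b" using * by auto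
      then show "\<bar>f (r i) - f (l i)\<bar> \<le> L * (r i - l i)" using lip[of "r i" "l i"] by simp
    qed
    also have "\<dots> = L * (\<Sum>i<n. r i - l i)" by (rule sum_distrib_left[symmetric])
    also have "\<dots> \<le> L * (e / (L + 1))" using * L by (intro mult_left_mono) auto
    also have "\<dots> < e" using e L by (simp add: field_simps)
    finally show "(\<Sum>i<n. \<bar>f (r i) - f (l i)\<bar>) < e" .
  qed
qed

lemma abs_continuous_on_imp_continuous_on:
  assumes "abs_continuous_on a b f"
  shows "continuous_on {a..b} f"
  unfolding continuous_on_iff
proof (intro ballI allI impI)
  fix s e :: real assume s: "s \<in> {a..b}" and "e > 0"
  from assms[unfolded abs_continuous_on_def, THEN spec, THEN mp, OF \<open>e > 0\<close>]
  obtain \<delta> where \<delta>: "\<delta> > 0" and ac: "\<forall>(n::nat) (l::nat \<Rightarrow> real) (r::nat \<Rightarrow> real).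
        (\<forall>i<n. a \<le> l i \<and> l i \<le> r i \<and> r i \<le> b) \<and>
        (\<forall>i<n. \<forall>j<n. i \<noteq> j \<longrightarrow> r i \<le> l j \<or> r j \<le> l i) \<and>
        (\<Sum>i<n. r i - l i) < \<delta> \<longrightarrow> (\<Sum>i<n. \<bar>f (r i) - f (l i)\<bar>) < e"
    by (elim exE conjE) (rule that)
  have "\<bar>f t - f s\<bar> < e" if t: "t \<in> {a..b}" "\<bar>t - s\<bar> < \<delta>" for t
    \<comment> \<open>A single interval, with the two points put in order.\<close>
    using ac[THEN spec[of _ "1"], THEN spec[of _ "\<lambda>_. min s t"], THEN spec[of _ "\<lambda>_. max s t"]] s t
    by (cases "s \<le> t") (auto simp: min_def max_def abs_minus_commute)
  then show "\<exists>d>0. \<forall>t\<in>{a..b}. dist t s < d \<longrightarrow> dist (f t) (f s) < e"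
    using \<delta> by (auto simp: dist_real_def)
qed

lemma abs_cos_diff_le: "\<bar>cos s - cos t\<bar> \<le> \<bar>s - t\<bar>" for s t :: real
proof -
  have "\<bar>cos s - cos t\<bar> = 2 * (\<bar>sin ((s + t) / 2)\<bar> * \<bar>sin ((t - s) / 2)\<bar>)"
    by (simp add: cos_diff_cos abs_mult)
  also have "\<dots> \<le> 2 * (1 * \<bar>(t - s) / 2\<bar>)"
    by (intro mult_left_mono mult_mono abs_sin_x_le_abs_x) auto
  finally show ?thesis by (simp add: abs_minus_commute)
qed

lemma abs_sin_diff_le: "\<bar>sin s - sin t\<bar> \<le> \<bar>s - t\<bar>" for s t :: real
proof -
  have "\<bar>sin s - sin t\<bar> = 2 * (\<bar>sin ((s - t) / 2)\<bar> * \<bar>cos ((s + t) / 2)\<bar>)"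
    by (simp add: sin_diff_sin abs_mult)
  also have "\<dots> \<le> 2 * (\<bar>(s - t) / 2\<bar> * 1)"
    by (intro mult_left_mono mult_mono abs_sin_x_le_abs_x) auto
  finally show ?thesis by simp
qed

text \<open>Integration by parts in \<open>\<theta>\<close>: the boundary term \<open>P\<close>
  vanishes at 0 and \<open>pi\<close>, and \<open>sin \<theta> * sin (k \<theta>)\<close> splits
  into cosines with \<open>k - 1\<close> and \<open>k + 1\<close>. As the derivative exists only
  almost everywhere, the fundamental theorem for absolutely continuous functions is applied to
  \<open>P\<close>.\<close>

lemma cheb_coeff_deriv:
  assumes ac: "abs_continuous_on (-1) 1 f"
    and deriv: "AE t in lebesgue. t \<in> {-1<..<1} \<longrightarrow> (f has_real_derivative h t) (at t)"
    and disc: "countable {t \<in> {-1..1}. \<not> continuous (at t within {-1..1}) h}"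
    and bound: "\<And>t. t \<in> {-1..1} \<Longrightarrow> \<bar>h t\<bar> \<le> B"
    and int: "\<And>j. (\<lambda>\<theta>. h (cos \<theta>) * cos (real j * \<theta>)) integrable_on {0..pi}"
    and k: "k \<ge> 1"
  shows "cheb_coeff f k = (cheb_coeff h (k - 1) - cheb_coeff h (k + 1)) / (2 * real k)"
proof -
  define C where "C = {t \<in> {-1..1}. \<not> continuous (at t within {-1..1}) h}"
  have B: "0 \<le> B" using bound[of 0] by auto
  have ftc: "(h has_integral (f t - f s)) {s..t}" if "-1 \<le> s" "s \<le> t" "t \<le> 1" for s t
  proof (rule abs_continuous_on_imp_has_integral)
    show "abs_continuous_on s t f" by (rule abs_continuous_on_subinterval[OF ac that(1,3)])
    show "AE u in lebesgue. u \<in> {s<..<t} \<longrightarrow> (f has_real_derivative h u) (at u)"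
      using deriv by eventually_elim (use that in auto)
  qed (rule that)
  have lip1: "\<bar>f t - f s\<bar> \<le> B * (t - s)" if "-1 \<le> s" "s \<le> t" "t \<le> 1" for s t
    using has_integral_bound_real[of B "{}" h "f t - f s" s t] ftc[OF that] bound B that by auto
  have lip: "\<bar>f s - f t\<bar> \<le> B * \<bar>s - t\<bar>" if "s \<in> {-1..1}" "t \<in> {-1..1}" for s t
    using lip1[of s t] lip1[of t s] that by (cases "s \<le> t") (auto simp: abs_minus_commute)
  \<comment> \<open>Writing \<open>f\<close> as \<open>f (-1)\<close> plus the integral of
    \<open>h\<close> gives the derivative at every interior continuity point of \<open>h\<close>, so
    the exceptional null set is replaced by a countable one.\<close>
  have df: "(f has_real_derivative h t) (at t)" if t: "t \<in> {-1<..<1}" "t \<notin> C" for t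
  proof -
    have "((\<lambda>u. integral {-1..u} h) has_vector_derivative h t) (at t within {-1..1} - {})"
      using ftc[of "-1" 1] t by (intro integral_has_vector_derivative_continuous_at) (auto simp: C_def)
    then have "((\<lambda>u. integral {-1..u} h) has_real_derivative h t) (at t)"
      using t by (simp add: has_real_derivative_iff_has_vector_derivative at_within_Icc_at)
    then have "((\<lambda>u. f (-1) + integral {-1..u} h) has_real_derivative h t) (at t)"
      by (auto intro!: derivative_eq_intros)
    moreover have "f (-1) + integral {-1..u} h = f u" if "u \<in> {-1<..<1}" for u
      using integral_unique[OF ftc[of "-1" u]] that by simp
    ultimately show ?thesis
      using has_field_derivative_transform_within_open[of _ "h t" t "{-1<..<1}" f] t by auto
  qed
  define P where "P \<theta> = f (cos \<theta>) * (sin (real k * \<theta>) / real k)" for \<theta>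
  define P' where "P' \<theta> = f (cos \<theta>) * cos (real k * \<theta>) - h (cos \<theta>) * sin \<theta> * (sin (real k * \<theta>) / real k)" for \<theta>
  have "(P' has_integral (P pi - P 0)) {0..pi}"
  proof (rule abs_continuous_on_imp_has_integral)
    define M where "M = \<bar>f 0\<bar> + B"
    have M: "\<bar>f t\<bar> \<le> M" if "t \<in> {-1..1}" for t
    proof -
      have "\<bar>f t - f 0\<bar> \<le> B * \<bar>t - 0\<bar>" using that by (intro lip) auto
      also have "\<dots> \<le> B * 1" using that B by (intro mult_left_mono) auto
      finally show ?thesis by (auto simp: M_def)
    qed
    \<comment> \<open>\<open>f (cos \<theta>)\<close> is \<open>B\<close>-Lipschitz and bounded by
      \<open>M\<close>, while \<open>sin (k \<theta>) / k\<close> is 1-Lipschitz and bounded by 1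
      because \<open>k \<ge> 1\<close>.\<close>
    show "abs_continuous_on 0 pi P"
    proof (rule abs_continuous_on_lipschitz)
      show "0 \<le> B + M" using B by (simp add: M_def)
      fix s t :: real
      let ?S = "\<lambda>t. sin (real k * t) / real k"
      have 1: "\<bar>f (cos s) - f (cos t)\<bar> \<le> B * \<bar>s - t\<bar>"
        using lip[of "cos s" "cos t"] mult_left_mono[OF abs_cos_diff_le B] by (force intro: order_trans)
      have 2: "\<bar>?S s\<bar> \<le> 1"
        using k order_trans[OF abs_sin_le_one, of "real k"] by (simp add: field_simps)
      have "\<bar>?S s - ?S t\<bar> = \<bar>sin (real k * s) - sin (real k * t)\<bar> / real k"
        by (simp flip: diff_divide_distrib)
      also have "\<dots> \<le> \<bar>real k * s - real k * t\<bar> / real k" by (intro divide_right_mono abs_sin_diff_le) auto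
      also have "\<dots> = \<bar>s - t\<bar>" using k by (simp add: abs_mult flip: right_diff_distrib)
      finally have 3: "\<bar>?S s - ?S t\<bar> \<le> \<bar>s - t\<bar>" .
      have "\<bar>P s - P t\<bar> = \<bar>(f (cos s) - f (cos t)) * ?S s + f (cos t) * (?S s - ?S t)\<bar>"
        unfolding P_def by (simp only: algebra_simps)
      also have "\<dots> \<le> \<bar>f (cos s) - f (cos t)\<bar> * \<bar>?S s\<bar> + \<bar>f (cos t)\<bar> * \<bar>?S s - ?S t\<bar>"
        unfolding abs_mult[symmetric] by (rule abs_triangle_ineq)
      also have "\<dots> \<le> (B * \<bar>s - t\<bar>) * 1 + M * \<bar>s - t\<bar>"
        using 1 2 3 M[of "cos t"] B by (intro add_mono mult_mono) auto
      finally show "\<bar>P s - P t\<bar> \<le> (B + M) * \<bar>s - t\<bar>" by (simp add: algebra_simps)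
    qed
    \<comment> \<open>Countability passes through \<open>arccos\<close>, so the exceptional angles
      form a null set without transporting a general null set.\<close>
    have "countable (arccos ` C)" using disc by (simp add: C_def)
    then have "AE \<theta> in lebesgue. \<theta> \<notin> arccos ` C"
      by (intro AE_not_in null_sets_completionI countable_imp_null_set_lborel)
    then show "AE \<theta> in lebesgue. \<theta> \<in> {0<..<pi} \<longrightarrow> (P has_real_derivative P' \<theta>) (at \<theta>)"
    proof eventually_elim
      case (elim \<theta>)
      show ?case
      proof
        assume \<theta>: "\<theta> \<in> {0<..<pi}"
        then have "arccos (cos \<theta>) = \<theta>" by (intro arccos_cos) auto
        then have nC: "cos \<theta> \<notin> C" using elim by (metis imageI)
        have "cos \<theta> \<in> {-1<..<1}"
          using \<theta> cos_monotone_0_pi[of 0 \<theta>] cos_monotone_0_pi[of \<theta> pi] by auto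
        then have "(f has_real_derivative h (cos \<theta>)) (at (cos \<theta>))" using nC by (rule df)
        then have d1: "((\<lambda>\<theta>. f (cos \<theta>)) has_real_derivative h (cos \<theta>) * - sin \<theta>) (at \<theta>)"
          by (rule DERIV_chain2) (auto intro!: derivative_eq_intros)
        have d2: "((\<lambda>\<theta>. sin (real k * \<theta>) / real k) has_real_derivative cos (real k * \<theta>)) (at \<theta>)"
          using k by (auto intro!: derivative_eq_intros)
        show "(P has_real_derivative P' \<theta>) (at \<theta>)"
          unfolding P_def[abs_def] P'_def by (rule DERIV_cong[OF DERIV_mult[OF d1 d2]]) simp
      qed
    qed
  qed simp
  then have "(P' has_integral 0) {0..pi}" by (simp add: P_def)
  \<comment> \<open>\<open>H\<close> is the part that carries \<open>h\<close>: added to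
    \<open>P'\<close> it gives back the integrand for \<open>f\<close>, and \<open>P'\<close>
    integrates to 0.\<close>
  moreover define H where "H \<theta> = (h (cos \<theta>) * cos (real (k - 1) * \<theta>) - h (cos \<theta>) * cos (real (k + 1) * \<theta>)) / (2 * real k)" for \<theta>
  have H_int: "(H has_integral (integral {0..pi} (\<lambda>\<theta>. h (cos \<theta>) * cos (real (k - 1) * \<theta>))
      - integral {0..pi} (\<lambda>\<theta>. h (cos \<theta>) * cos (real (k + 1) * \<theta>))) / (2 * real k)) {0..pi}"
    unfolding H_def by (intro has_integral_divide has_integral_diff integrable_integral int)
  moreover have "P' \<theta> + H \<theta> = f (cos \<theta>) * cos (real k * \<theta>)" for \<theta>
  proof -
    have "cos (real (k - 1) * \<theta>) - cos (real (k + 1) * \<theta>) = 2 * (sin \<theta> * sin (real k * \<theta>))"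
      using cos_add[of "real k * \<theta>" \<theta>] cos_diff[of "real k * \<theta>" \<theta>] k
      by (simp add: of_nat_diff algebra_simps)
    then have "H \<theta> = h (cos \<theta>) * (2 * (sin \<theta> * sin (real k * \<theta>))) / (2 * real k)"
      unfolding H_def by (simp flip: right_diff_distrib)
    then show ?thesis using k by (simp add: P'_def)
  qed
  ultimately have "integral {0..pi} (\<lambda>\<theta>. f (cos \<theta>) * cos (real k * \<theta>)) =
      (integral {0..pi} (\<lambda>\<theta>. h (cos \<theta>) * cos (real (k - 1) * \<theta>))
      - integral {0..pi} (\<lambda>\<theta>. h (cos \<theta>) * cos (real (k + 1) * \<theta>))) / (2 * real k)"
    using has_integral_add[of P' 0 "{0..pi}" H] by (simp add: integral_unique)
  then show ?thesis unfolding cheb_coeff_def by (simp add: field_simps)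
qed

text \<open>Induction on \<open>m\<close> with the shifted sequence \<open>fs (Suc i)\<close>. The
  base case is the \<open>1 / k\<close> decay for bounded variation; each integration by parts
  brings the indices \<open>k - 1\<close> and \<open>k + 1\<close> and a factor
  \<open>1 / (2 k)\<close>. \<open>m < k\<close> keeps all factors of the product positive.\<close>

lemma abs_cheb_coeff_le_smooth:
  fixes fs :: "nat \<Rightarrow> real \<Rightarrow> real"
  assumes "\<forall>i<m. abs_continuous_on (-1) 1 (fs i)"
    and "\<forall>i<m. AE t in lebesgue. t \<in> {-1<..<1} \<longrightarrow> (fs i has_real_derivative fs (Suc i) t) (at t)"
    and "bounded_variation_on (-1) 1 (fs m)" and "m < k"
  shows "\<bar>cheb_coeff (fs 0) k\<bar> \<le> 2 * total_variation (-1) 1 (fs m) / (pi * (\<Prod>i\<le>m. real k - real i))"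
  using assms
proof (induction m arbitrary: fs k)
  case 0
  then have "\<bar>cheb_coeff (fs 0) k\<bar> \<le> 2 / pi * (total_variation (-1) 1 (fs 0) / real k)"
    unfolding cheb_coeff_def abs_mult
    by (intro mult_mono bounded_variation_cos_integral(2)) auto
  then show ?case by simp
next
  case (Suc m)
  define h where "h = fs (Suc 0)"
  define V where "V = total_variation (-1) 1 (fs (Suc m))"
  have IH: "\<bar>cheb_coeff h j\<bar> \<le> 2 * V / (pi * (\<Prod>i\<le>m. real j - real i))" if "m < j" for j
    unfolding h_def V_def using Suc.IH[of "\<lambda>i. fs (Suc i)" j] Suc.prems that by auto
  have V: "0 \<le> V"
    using bounded_variation_cos_integral(2)[OF Suc.prems(3), of 1] by (simp add: V_def)
  have ac: "abs_continuous_on (-1) 1 (fs 0)"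
    and deriv: "AE t in lebesgue. t \<in> {-1<..<1} \<longrightarrow> (fs 0 has_real_derivative h t) (at t)"
    using Suc.prems by (auto simp: h_def)
  \<comment> \<open>For \<open>m = 0\<close> the function \<open>h\<close> is itself of bounded
    variation; otherwise it is absolutely continuous, hence continuous and bounded.\<close>
  have "\<exists>B. countable {t \<in> {-1..1}. \<not> continuous (at t within {-1..1}) h} \<and>
      (\<forall>t\<in>{-1..1}. \<bar>h t\<bar> \<le> B) \<and> (\<forall>j. (\<lambda>\<theta>. h (cos \<theta>) * cos (real j * \<theta>)) integrable_on {0..pi})"
  proof (cases m)
    case 0
    then have "bounded_variation_on (-1) 1 h" using Suc.prems(3) by (simp add: h_def)
    then show ?thesis
      using bounded_variation_countable_discont[of "-1" 1 h] bounded_variation_bounded[of "-1" 1 h]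
        bounded_variation_cos_integral(1)[of h]
      by (intro exI[of _ "\<bar>h (-1)\<bar> + total_variation (-1) 1 h"]) auto
  next
    case (Suc m')
    then have cont: "continuous_on {-1..1} h"
      using Suc.prems(1) by (intro abs_continuous_on_imp_continuous_on) (simp add: h_def)
    then have "bounded (h ` {-1..1})"
      by (intro compact_imp_bounded compact_continuous_image) auto
    then obtain B where "\<forall>t\<in>{-1..1}. \<bar>h t\<bar> \<le> B" unfolding bounded_iff by auto
    moreover have "countable {t \<in> {-1..1}. \<not> continuous (at t within {-1..1}) h}"
    proof -
      have "{t \<in> {-1..1}. \<not> continuous (at t within {-1..1}) h} = {}"
        using cont by (auto simp: continuous_on_eq_continuous_within)
      then show ?thesis by (simp only: countable_empty)
    qed
    moreover have "(\<lambda>\<theta>. h (cos \<theta>) * cos (real j * \<theta>)) integrable_on {0..pi}" for j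
      by (intro integrable_continuous_real continuous_intros continuous_on_compose2[OF cont]) auto
    ultimately show ?thesis by blast
  qed
  then obtain B where disc: "countable {t \<in> {-1..1}. \<not> continuous (at t within {-1..1}) h}"
    and B: "\<And>t. t \<in> {-1..1} \<Longrightarrow> \<bar>h t\<bar> \<le> B"
    and int: "\<And>j. (\<lambda>\<theta>. h (cos \<theta>) * cos (real j * \<theta>)) integrable_on {0..pi}"
    by blast
  have k: "Suc m < k" using Suc.prems(4) .
  define Q where "Q = (\<Prod>i\<le>m. real (k - 1) - real i)"
  have Q: "0 < Q" unfolding Q_def using k by (intro prod_pos) auto
  \<comment> \<open>The product is smaller at \<open>k - 1\<close> than at \<open>k + 1\<close>, so
    its bound serves for both coefficients.\<close>
  have "Q \<le> (\<Prod>i\<le>m. real (k + 1) - real i)"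
    unfolding Q_def using k by (intro prod_mono) auto
  then have "2 * V / (pi * (\<Prod>i\<le>m. real (k + 1) - real i)) \<le> 2 * V / (pi * Q)"
    using V Q by (intro divide_left_mono mult_left_mono mult_pos_pos) auto
  then have 1: "\<bar>cheb_coeff h (k + 1)\<bar> \<le> 2 * V / (pi * Q)" using IH[of "k + 1"] k by simp
  have 2: "\<bar>cheb_coeff h (k - 1)\<bar> \<le> 2 * V / (pi * Q)" using IH[of "k - 1"] k by (simp add: Q_def)
  have "cheb_coeff (fs 0) k = (cheb_coeff h (k - 1) - cheb_coeff h (k + 1)) / (2 * real k)"
    by (rule cheb_coeff_deriv[OF ac deriv disc B int]) (use k in auto)
  then have "\<bar>cheb_coeff (fs 0) k\<bar> = \<bar>cheb_coeff h (k - 1) - cheb_coeff h (k + 1)\<bar> / (2 * real k)" by simp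
  also have "\<dots> \<le> (2 * (2 * V / (pi * Q))) / (2 * real k)"
    using 1 2 by (intro divide_right_mono) auto
  also have "\<dots> = 2 * V / (pi * (real k * Q))" by simp
  \<comment> \<open>The factor \<open>k\<close> is the term \<open>i = 0\<close>; the rest is
    shifted by \<open>(k - 1) - i = k - (i + 1)\<close>.\<close>
  also have "real k * Q = (\<Prod>i\<le>Suc m. real k - real i)"
    unfolding Q_def prod.atMost_Suc_shift using k by (simp add: of_nat_diff algebra_simps)
  finally show ?case unfolding V_def .
qed

text \<open>With \<open>P k = (k - 1) ... (k - m)\<close> the summand is
  \<open>(1 / P k - 1 / P (k + 1)) / m\<close>, because \<open>P k\<close> and
  \<open>P (k + 1)\<close> share all factors but \<open>k - m\<close> and \<open>k\<close>. The sum
  telescopes and the positive last term is dropped.\<close>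

lemma sum_inverse_falling_factorial_le:
  assumes m: "m \<ge> 1" and s: "m < s"
  shows "(\<Sum>k=s..<N. 1 / (\<Prod>i\<le>m. real k - real i)) \<le> 1 / (real m * (\<Prod>i=1..m. real s - real i))"
proof -
  define P where "P k = (\<Prod>i=1..m. real k - real i)" for k
  have P: "0 < P k" if "m < k" for k unfolding P_def using that by (intro prod_pos) auto
  have telescope: "1 / (\<Prod>i\<le>m. real k - real i) = (1 / P k - 1 / P (Suc k)) / real m" if k: "m < k" for k
  proof -
    define Q where "Q = (\<Prod>i=1..<m. real k - real i)"
    have Q: "0 < Q" unfolding Q_def using k by (intro prod_pos) auto
    obtain m' where m': "m = Suc m'" using m by (cases m) auto
    have PQ: "P k = Q * (real k - real m)"
      unfolding P_def Q_def m' by (simp add: atLeastLessThanSuc_atLeastAtMost)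
    have "P (Suc k) = (\<Prod>i=0..<m. real (Suc k) - real (Suc i))"
      unfolding P_def by (subst prod.shift_bounds_Suc_ivl[symmetric]) (simp add: atLeastLessThanSuc_atLeastAtMost)
    also have "\<dots> = real k * Q"
      unfolding Q_def using m by (subst prod.atLeast_Suc_lessThan) auto
    finally have PS: "P (Suc k) = real k * Q" .
    have PP: "(\<Prod>i\<le>m. real k - real i) = real k * P k"
      unfolding P_def atMost_atLeast0 by (subst prod.atLeast_Suc_atMost) auto
    have "real k - real m \<noteq> 0" using k by simp
    then show ?thesis unfolding PP PS PQ using Q k m by (simp add: divide_simps)
  qed
  have "(\<Sum>k=s..<N. 1 / (\<Prod>i\<le>m. real k - real i)) = (1 / P s - 1 / P N) / real m" if "s \<le> N"
    using that
  proof (induction rule: dec_induct)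
    case (step N)
    then show ?case using telescope[of N] s by (simp add: diff_divide_distrib)
  qed simp
  moreover have "(1 / P s - 1 / P N) / real m \<le> 1 / (real m * P s)" if "s \<le> N"
  proof -
    have "(1 / P s - 1 / P N) / real m \<le> (1 / P s) / real m"
      using P[of N] s that by (intro divide_right_mono) auto
    then show ?thesis by (simp add: mult.commute)
  qed
  moreover have "0 \<le> 1 / (real m * P s)" using P[OF s] by simp
  ultimately show ?thesis unfolding P_def[symmetric] by (cases "s \<le> N") auto
qed

theorem (in gauss_quadrature) remainder_r_le_smooth:
  fixes fs :: "nat \<Rightarrow> real \<Rightarrow> real"
  assumes m: "m \<ge> 1" and n: "n \<ge> (m + 2) div 2"
    and ac: "\<forall>i<m. abs_continuous_on (-1) 1 (fs i)"
    and deriv: "\<forall>i<m. AE t in lebesgue. t \<in> {-1<..<1} \<longrightarrow> (fs i has_real_derivative fs (Suc i) t) (at t)"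
    and bv: "bounded_variation_on (-1) 1 (fs m)"
  shows "\<bar>remainder_r W n x w (fs 0)\<bar> \<le> 4 * integral {-1..1} W * total_variation (-1) 1 (fs m)
    / (pi * real m * (\<Prod>j=1..m. 2 * real n - real j))"
proof -
  let ?V = "total_variation (-1) 1 (fs m)"
  \<comment> \<open>\<open>(m + 2) div 2 \<le> n\<close> says exactly that \<open>m < 2 * n\<close>,
    so every index in the tail exceeds \<open>m\<close>.\<close>
  have mn: "m < 2 * n" using n by linarith
  have V: "0 \<le> ?V" using bounded_variation_cos_integral(2)[OF bv, of 1] by simp
  have "\<bar>remainder_r W n x w (fs 0)\<bar> \<le> 2 * integral {-1..1} W *
      (2 * ?V / pi * (1 / (real m * (\<Prod>j=1..m. real (2 * n) - real j))))"
  proof (rule remainder_le_cheb_tail)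
    show "continuous_on {-1..1} (fs 0)" using ac m by (intro abs_continuous_on_imp_continuous_on) simp
    fix N
    have "(\<Sum>k=2*n..<N. \<bar>cheb_coeff (fs 0) k\<bar>) \<le> (\<Sum>k=2*n..<N. 2 * ?V / pi * (1 / (\<Prod>i\<le>m. real k - real i)))"
    proof (rule sum_mono)
      fix k assume "k \<in> {2*n..<N}"
      then have "m < k" using mn by simp
      then show "\<bar>cheb_coeff (fs 0) k\<bar> \<le> 2 * ?V / pi * (1 / (\<Prod>i\<le>m. real k - real i))"
        using abs_cheb_coeff_le_smooth[OF ac deriv bv] by simp
    qed
    also have "\<dots> = 2 * ?V / pi * (\<Sum>k=2*n..<N. 1 / (\<Prod>i\<le>m. real k - real i))"
      by (rule sum_distrib_left[symmetric])
    also have "\<dots> \<le> 2 * ?V / pi * (1 / (real m * (\<Prod>j=1..m. real (2 * n) - real j)))"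
      using V by (intro mult_left_mono sum_inverse_falling_factorial_le m mn) auto
    finally show "(\<Sum>k=2*n..<N. \<bar>cheb_coeff (fs 0) k\<bar>) \<le> \<dots>" .
  qed
  then show ?thesis by (simp add: mult_ac)
qed

section \<open>The two error bounds for the composed weight\<close>

theorem theorem2p1:
  fixes g :: "real \<Rightarrow> real" and \<omega> :: real and \<phi> :: "real \<Rightarrow> real"
    and n :: nat and x w :: "nat \<Rightarrow> real"
  assumes g_nonneg: "\<forall>t\<in>{-1..1}. g t \<ge> 0"
    and g_smooth: "\<exists>G :: nat \<Rightarrow> real \<Rightarrow> real. (\<forall>t\<in>{-1..1}. G 0 t = g t) \<and>
        (\<forall>k. \<forall>t\<in>{-1..1}. (G k has_real_derivative G (Suc k) t) (at t within {-1..1}))"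
    and \<omega>_pos: "\<omega> > 0"
    and \<phi>_def: "\<phi> = (\<lambda>t. sin (\<omega> * t)) \<or> \<phi> = (\<lambda>t. cos (\<omega> * t))"
    and W_nonzero: "\<not> (AE t in lebesgue. t \<in> {-1..1} \<longrightarrow> (g \<circ> \<phi>) t = 0)"
    and gauss: "gauss_rule (g \<circ> \<phi>) n x w"
  shows
    "(\<forall>(\<rho>::real) (M::real) (f::complex \<Rightarrow> complex).
        \<rho> > 1 \<and> f holomorphic_on ellipse_region \<rho> \<and>
        (\<forall>z\<in>ellipse_region \<rho>. cmod (f z) \<le> M) \<longrightarrow>
        cmod (remainder_c (g \<circ> \<phi>) n x w f)
          \<le> 4 * integral {-1..1} (g \<circ> \<phi>) * M / (\<rho> ^ (2 * n) * (1 - 1 / \<rho>)))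
     \<and>
     (\<forall>(m::nat) (fs::nat \<Rightarrow> real \<Rightarrow> real) (V::real).
        m \<ge> 1 \<and> n \<ge> (m + 2) div 2 \<and>
        (\<forall>k<m. abs_continuous_on (-1) 1 (fs k)) \<and>
        (\<forall>k<m. AE t in lebesgue. t \<in> {-1<..<1} \<longrightarrow>
                (fs k has_real_derivative fs (Suc k) t) (at t)) \<and>
        bounded_variation_on (-1) 1 (fs m) \<and> V = total_variation (-1) 1 (fs m) \<longrightarrow>
        \<bar>remainder_r (g \<circ> \<phi>) n x w (fs 0)\<bar>
          \<le> 4 * integral {-1..1} (g \<circ> \<phi>) * V
             / (pi * real m * (\<Prod>j=1..m. (2 * real n - real j))))"
proof -
  have \<phi>_mem: "\<phi> t \<in> {-1..1}" for t using \<phi>_def by auto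
  have \<phi>_cont: "continuous_on S \<phi>" for S using \<phi>_def by (auto intro!: continuous_intros)
  from g_smooth obtain G where G: "\<forall>t\<in>{-1..1}. G (0::nat) t = g t"
    "\<forall>k. \<forall>t\<in>{-1..1}. (G k has_real_derivative G (Suc k) t) (at t within {-1..1})"
    by (elim exE conjE)
  \<comment> \<open>Differentiability of \<open>G 0\<close> makes \<open>g\<close> continuous, and
    \<open>\<phi>\<close> carries this over to the weight because its values lie in the
    interval.\<close>
  have "continuous_on {-1..1} (G 0)" by (rule DERIV_continuous_on) (use G(2) in blast)
  then have "continuous_on {-1..1} g" by (rule continuous_on_eq) (use G(1) in blast)
  then have W_cont: "continuous_on {-1..1} (g \<circ> \<phi>)"
    using \<phi>_cont \<phi>_mem by (intro continuous_on_compose) (auto intro: continuous_on_subset)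
  interpret gauss_quadrature "g \<circ> \<phi>" n x w
  proof
    show "\<exists>t\<in>{-1..1}. (g \<circ> \<phi>) t \<noteq> 0"
    proof (rule ccontr)
      assume "\<not> ?thesis"
      then have "AE t in lebesgue. t \<in> {-1..1} \<longrightarrow> (g \<circ> \<phi>) t = 0" by (intro AE_I2) blast
      then show False using W_nonzero by blast
    qed
    show "0 \<le> (g \<circ> \<phi>) t" for t using g_nonneg \<phi>_mem by simp
    show "integral {-1..1} (\<lambda>t. poly q t * (g \<circ> \<phi>) t) = (\<Sum>k=1..n. w k * poly q (x k))"
      if "degree q < 2 * n" for q
      using gauss that unfolding gauss_rule_def by blast
  qed (rule W_cont)
  show ?thesis
  proof (intro conjI allI impI; elim conjE)
    fix \<rho> M :: real and f :: "complex \<Rightarrow> complex"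
    assume "\<rho> > 1" "f holomorphic_on ellipse_region \<rho>" "\<forall>z\<in>ellipse_region \<rho>. cmod (f z) \<le> M"
    then show "cmod (remainder_c (g \<circ> \<phi>) n x w f)
        \<le> 4 * integral {-1..1} (g \<circ> \<phi>) * M / (\<rho> ^ (2 * n) * (1 - 1 / \<rho>))"
      by (intro remainder_c_le_analytic) auto
  next
    fix m :: nat and fs :: "nat \<Rightarrow> real \<Rightarrow> real" and V :: real
    assume hyps: "m \<ge> 1" "n \<ge> (m + 2) div 2" "\<forall>k<m. abs_continuous_on (-1) 1 (fs k)"
      "\<forall>k<m. AE t in lebesgue. t \<in> {-1<..<1} \<longrightarrow> (fs k has_real_derivative fs (Suc k) t) (at t)"
      "bounded_variation_on (-1) 1 (fs m)"
      and V: "V = total_variation (-1) 1 (fs m)"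
    show "\<bar>remainder_r (g \<circ> \<phi>) n x w (fs 0)\<bar>
        \<le> 4 * integral {-1..1} (g \<circ> \<phi>) * V / (pi * real m * (\<Prod>j=1..m. (2 * real n - real j)))"
      unfolding V by (rule remainder_r_le_smooth[OF hyps])
  qed
qed

end
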